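(* The rules $i{\uparrow}$, $w{\uparrow}$, $c{\uparrow}$, $u{\uparrow}$ and $n{\uparrow}$ are admissible for system $\mathsf{KSgq}$.
   Context: First-order terms are as usual; atoms are expressions $p(t_1,\dots,t_n)$ with $p$ a predicate symbol of arity $n$, and the negation of an atom is again an atom. Structures: $S ::= \mathsf f \mid \mathsf t \mid a \mid [S,\dots,S] \mid (S,\dots,S) \mid \bar S \mid \exists x S \mid \forall x S$ (non-empty lists), with $[\cdot]$ disjunction, $(\cdot)$ conjunction, $\bar S$ negation. A context $S\{\ \}$ is a structure with one occurrence of a hole, not in the scope of a negation; $S\{R\}$ fills the hole with $R$ (quantifiers of $S$ may capture variables of $R$); $S[R,T]$ abbreviates $S\{[R,T]\}$, $S(R,T)$ abbreviates $S\{(R,T)\}$. $R[x/t]$ denotes substitution of the term $t$ for $x$ in $R$, where $t$ must be free for $x$ in $R$. Equivalent structures are not distinguished; equivalence is the smallest equivalence relation induced by: $[\vec R,[\vec T],\vec U]=[\vec R,\vec T,\vec U]$, $(\vec R,(\vec T),\vec U)=(\vec R,\vec T,\vec U)$ ($\vec T$ non-empty); $[R,T]=[T,R]$, $(R,T)=(T,R)$; $(\mathsf f,\mathsf f)=\mathsf f$, $[\mathsf f,R]=R$, $[\mathsf t,\mathsf t]=\mathsf t$, $(\mathsf t,R)=R$; $\bar{\mathsf f}=\mathsf t$, $\bar{\mathsf t}=\mathsf f$, $\overline{[R,T]}=(\bar R,\bar T)$, $\overline{(R,T)}=[\bar R,\bar T]$, $\bar{\bar R}=R$, $\overline{\exists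 xR}=\forall x\bar R$, $\overline{\forall xR}=\exists x\bar R$; $\forall xR=\forall yR[x/y]$ and $\exists xR=\exists yR[x/y]$ if $y$ is not free in $R$; $\forall yR=\exists yR=R$ if $y$ is not free in $R$; and closure: if $R=T$ then $S\{R\}=S\{T\}$ and $\bar R=\bar T$. A derivation in a system (set of inference rules) is a finite sequence of rule instances, read top-down, the conclusion of each being the premise of the next; it may consist of a single structure. A proof of $R$ is a derivation with premise $\mathsf t$ and conclusion $R$. Rules (written $\frac{\text{premise}}{\text{conclusion}}$): $i{\downarrow}:\frac{S\{\mathsf t\}}{S[R,\bar R]}$, $i{\uparrow}$ (cut)$:\frac{S(R,\bar R)}{S\{\mathsf f\}}$, $s:\frac{S([R,U],T)}{S[(R,T),U]}$, $w{\downarrow}:\frac{S\{\mathsf f\}}{S\{R\}}$, $w{\uparrow}:\frac{S\{R\}}{S\{\mathsf t\}}$, $c{\downarrow}:\frac{S[R,R]}{S\{R\}}$, $c{\uparrow}:\frac{S\{R\}}{S(R,R)}$, $u{\downarrow}:\frac{S\{\forall x[R,T]\}}{S[\forall xR,\exists xT]}$, $u{\uparrow}:\frac{S(\exists xR,\forall xT)}{S\{\exists x(R,T)\}}$, $n{\downarrow}:\frac{S\{R[x/t]\}}{S\{\exists xR\}}$, $n{\uparrow}:\frac{S\{\forall xR\}}{S\{R[x/t]\}}$. System $\mathsf{KSgq}$ is $\{i{\downarrow},s,w{\downarrow},c{\downarrow},u{\downarrow},n{\downarrow}\}$. A rule $\rho$ is admissible for a system $\mathcal S$ if for every proof of a structure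 in $\mathcal S\cup\{\rho\}$ there is a proof of the same structure in $\mathcal S$. *)

theory Defs
  imports Main
begin

section \<open>Terms, atoms and structures\<close>

datatype 'f trm = Var nat | Fun 'f "'f trm list"

text \<open>The negation of an atom is again an atom, so atoms come in two polarities.\<close>

datatype ('f, 'p) atom = Pos 'p "'f trm list" | Neg 'p "'f trm list"

datatype ('f, 'p) struct =
    FF
  | TT
  | Atm "('f, 'p) atom"
  | Dis "('f, 'p) struct list"
  | Con "('f, 'p) struct list"
  | Bar "('f, 'p) struct"
  | Exi nat "('f, 'p) struct"
  | Uni nat "('f, 'p) struct"

fun neg_atom :: "('f, 'p) atom \<Rightarrow> ('f, 'p) atom" where
  "neg_atom (Pos p ts) = Neg p ts"
| "neg_atom (Neg p ts) = Pos p ts"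

text \<open>A signature is given by sets \<open>F\<close> and \<open>P\<close> of function and predicate symbols paired with
  their arities. Well-formedness also expresses that lists in structures are non-empty.\<close>

fun wf_trm :: "('f \<times> nat) set \<Rightarrow> 'f trm \<Rightarrow> bool" where
  "wf_trm F (Var x) \<longleftrightarrow> True"
| "wf_trm F (Fun f ts) \<longleftrightarrow> (f, length ts) \<in> F \<and> (\<forall>t\<in>set ts. wf_trm F t)"

fun wf_atom :: "('f \<times> nat) set \<Rightarrow> ('p \<times> nat) set \<Rightarrow> ('f, 'p) atom \<Rightarrow> bool" where
  "wf_atom F P (Pos p ts) \<longleftrightarrow> (p, length ts) \<in> P \<and> (\<forall>t\<in>set ts. wf_trm F t)"
| "wf_atom F P (Neg p ts) \<longleftrightarrow> (p, length ts) \<in> P \<and> (\<forall>t\<in>set ts. wf_trm F t)"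

fun wf_struct :: "('f \<times> nat) set \<Rightarrow> ('p \<times> nat) set \<Rightarrow> ('f, 'p) struct \<Rightarrow> bool" where
  "wf_struct F P FF \<longleftrightarrow> True"
| "wf_struct F P TT \<longleftrightarrow> True"
| "wf_struct F P (Atm a) \<longleftrightarrow> wf_atom F P a"
| "wf_struct F P (Dis Rs) \<longleftrightarrow> Rs \<noteq> [] \<and> (\<forall>R\<in>set Rs. wf_struct F P R)"
| "wf_struct F P (Con Rs) \<longleftrightarrow> Rs \<noteq> [] \<and> (\<forall>R\<in>set Rs. wf_struct F P R)"
| "wf_struct F P (Bar R) \<longleftrightarrow> wf_struct F P R"
| "wf_struct F P (Exi x R) \<longleftrightarrow> wf_struct F P R"
| "wf_struct F P (Uni x R) \<longleftrightarrow> wf_struct F P R"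


section \<open>Free variables and substitution\<close>

fun vars_trm :: "'f trm \<Rightarrow> nat set" where
  "vars_trm (Var x) = {x}"
| "vars_trm (Fun f ts) = (\<Union>t\<in>set ts. vars_trm t)"

fun vars_atom :: "('f, 'p) atom \<Rightarrow> nat set" where
  "vars_atom (Pos p ts) = (\<Union>t\<in>set ts. vars_trm t)"
| "vars_atom (Neg p ts) = (\<Union>t\<in>set ts. vars_trm t)"

fun fv :: "('f, 'p) struct \<Rightarrow> nat set" where
  "fv FF = {}"
| "fv TT = {}"
| "fv (Atm a) = vars_atom a"
| "fv (Dis Rs) = (\<Union>R\<in>set Rs. fv R)"
| "fv (Con Rs) = (\<Union>R\<in>set Rs. fv R)"
| "fv (Bar R) = fv R"
| "fv (Exi x R) = fv R - {x}"
| "fv (Uni x R) = fv R - {x}"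

fun subst_trm :: "nat \<Rightarrow> 'f trm \<Rightarrow> 'f trm \<Rightarrow> 'f trm" where
  "subst_trm x t (Var y) = (if y = x then t else Var y)"
| "subst_trm x t (Fun f ts) = Fun f (map (subst_trm x t) ts)"

fun subst_atom :: "nat \<Rightarrow> 'f trm \<Rightarrow> ('f, 'p) atom \<Rightarrow> ('f, 'p) atom" where
  "subst_atom x t (Pos p ts) = Pos p (map (subst_trm x t) ts)"
| "subst_atom x t (Neg p ts) = Neg p (map (subst_trm x t) ts)"

text \<open>\<open>subst x t R\<close> is \<open>R[x/t]\<close>. Bound variables are not renamed: substitution is only
  used together with \<open>free_for t x R\<close> below, which excludes capture.\<close>

fun subst :: "nat \<Rightarrow> 'f trm \<Rightarrow> ('f, 'p) struct \<Rightarrow> ('f, 'p) struct" where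
  "subst x t FF = FF"
| "subst x t TT = TT"
| "subst x t (Atm a) = Atm (subst_atom x t a)"
| "subst x t (Dis Rs) = Dis (map (subst x t) Rs)"
| "subst x t (Con Rs) = Con (map (subst x t) Rs)"
| "subst x t (Bar R) = Bar (subst x t R)"
| "subst x t (Exi y R) = (if y = x then Exi y R else Exi y (subst x t R))"
| "subst x t (Uni y R) = (if y = x then Uni y R else Uni y (subst x t R))"

fun free_for :: "'f trm \<Rightarrow> nat \<Rightarrow> ('f, 'p) struct \<Rightarrow> bool" where
  "free_for t x FF \<longleftrightarrow> True"
| "free_for t x TT \<longleftrightarrow> True"
| "free_for t x (Atm a) \<longleftrightarrow> True"
| "free_for t x (Dis Rs) \<longleftrightarrow> (\<forall>R\<in>set Rs. free_for t x R)"
| "free_for t x (Con Rs) \<longleftrightarrow> (\<forall>R\<in>set Rs. free_for t x R)"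
| "free_for t x (Bar R) \<longleftrightarrow> free_for t x R"
| "free_for t x (Exi y R) \<longleftrightarrow> x \<notin> fv (Exi y R) \<or> (y \<notin> vars_trm t \<and> free_for t x R)"
| "free_for t x (Uni y R) \<longleftrightarrow> x \<notin> fv (Uni y R) \<or> (y \<notin> vars_trm t \<and> free_for t x R)"


section \<open>Contexts\<close>

text \<open>There is no constructor for \<open>Bar\<close>: the hole must not occur in the scope of a negation.
  Negations may occur in the side structures.\<close>

datatype ('f, 'p) ctxt =
    Hole
  | CDis "('f, 'p) struct list" "('f, 'p) ctxt" "('f, 'p) struct list"
  | CCon "('f, 'p) struct list" "('f, 'p) ctxt" "('f, 'p) struct list"
  | CExi nat "('f, 'p) ctxt"
  | CUni nat "('f, 'p) ctxt"

primrec fill :: "('f, 'p) ctxt \<Rightarrow> ('f, 'p) struct \<Rightarrow> ('f, 'p) struct" where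
  "fill Hole R = R"
| "fill (CDis Rs S Us) R = Dis (Rs @ [fill S R] @ Us)"
| "fill (CCon Rs S Us) R = Con (Rs @ [fill S R] @ Us)"
| "fill (CExi x S) R = Exi x (fill S R)"
| "fill (CUni x S) R = Uni x (fill S R)"


section \<open>Equivalence of structures\<close>

text \<open>The clause \<open>bar_atom\<close> identifies the structure \<open>Bar (Atm a)\<close> with the negated atom.
  Well-formedness is not required here because each clause preserves it in both directions.\<close>

inductive equiv_struct :: "('f, 'p) struct \<Rightarrow> ('f, 'p) struct \<Rightarrow> bool" (infix "\<simeq>" 50) where
  refl: "R \<simeq> R"
| sym: "R \<simeq> T \<Longrightarrow> T \<simeq> R"
| trans: "R \<simeq> T \<Longrightarrow> T \<simeq> U \<Longrightarrow> R \<simeq> U"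
| assoc_dis: "Ts \<noteq> [] \<Longrightarrow> Dis (Rs @ [Dis Ts] @ Us) \<simeq> Dis (Rs @ Ts @ Us)"
| assoc_con: "Ts \<noteq> [] \<Longrightarrow> Con (Rs @ [Con Ts] @ Us) \<simeq> Con (Rs @ Ts @ Us)"
| comm_dis: "Dis [R, T] \<simeq> Dis [T, R]"
| comm_con: "Con [R, T] \<simeq> Con [T, R]"
| con_FF: "Con [FF, FF] \<simeq> FF"
| dis_FF: "Dis [FF, R] \<simeq> R"
| dis_TT: "Dis [TT, TT] \<simeq> TT"
| con_TT: "Con [TT, R] \<simeq> R"
| bar_FF: "Bar FF \<simeq> TT"
| bar_TT: "Bar TT \<simeq> FF"
| bar_atom: "Bar (Atm a) \<simeq> Atm (neg_atom a)"
| bar_dis: "Bar (Dis [R, T]) \<simeq> Con [Bar R, Bar T]"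
| bar_con: "Bar (Con [R, T]) \<simeq> Dis [Bar R, Bar T]"
| bar_bar: "Bar (Bar R) \<simeq> R"
| bar_exi: "Bar (Exi x R) \<simeq> Uni x (Bar R)"
| bar_uni: "Bar (Uni x R) \<simeq> Exi x (Bar R)"
| rename_uni: "y \<notin> fv R \<Longrightarrow> free_for (Var y) x R \<Longrightarrow> Uni x R \<simeq> Uni y (subst x (Var y) R)"
| rename_exi: "y \<notin> fv R \<Longrightarrow> free_for (Var y) x R \<Longrightarrow> Exi x R \<simeq> Exi y (subst x (Var y) R)"
| vacuous_uni: "y \<notin> fv R \<Longrightarrow> Uni y R \<simeq> R"
| vacuous_exi: "y \<notin> fv R \<Longrightarrow> Exi y R \<simeq> R"
| ctxt_closure: "R \<simeq> T \<Longrightarrow> fill S R \<simeq> fill S T"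
| bar_closure: "R \<simeq> T \<Longrightarrow> Bar R \<simeq> Bar T"


section \<open>Inference rules\<close>

text \<open>A rule is the relation between the premise and the conclusion of its instances.\<close>

type_synonym ('f, 'p) rule = "('f, 'p) struct \<Rightarrow> ('f, 'p) struct \<Rightarrow> bool"

inductive i_down :: "('f, 'p) rule" where
  "i_down (fill S TT) (fill S (Dis [R, Bar R]))"

inductive i_up :: "('f, 'p) rule" where
  "i_up (fill S (Con [R, Bar R])) (fill S FF)"

inductive switch :: "('f, 'p) rule" where
  "switch (fill S (Con [Dis [R, U], T])) (fill S (Dis [Con [R, T], U]))"

inductive w_down :: "('f, 'p) rule" where
  "w_down (fill S FF) (fill S R)"

inductive w_up :: "('f, 'p) rule" where
  "w_up (fill S R) (fill S TT)"

inductive c_down :: "('f, 'p) rule" where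
  "c_down (fill S (Dis [R, R])) (fill S R)"

inductive c_up :: "('f, 'p) rule" where
  "c_up (fill S R) (fill S (Con [R, R]))"

inductive u_down :: "('f, 'p) rule" where
  "u_down (fill S (Uni x (Dis [R, T]))) (fill S (Dis [Uni x R, Exi x T]))"

inductive u_up :: "('f, 'p) rule" where
  "u_up (fill S (Con [Exi x R, Uni x T])) (fill S (Exi x (Con [R, T])))"

inductive n_down :: "('f, 'p) rule" where
  "free_for t x R \<Longrightarrow> n_down (fill S (subst x t R)) (fill S (Exi x R))"

inductive n_up :: "('f, 'p) rule" where
  "free_for t x R \<Longrightarrow> n_up (fill S (Uni x R)) (fill S (subst x t R))"

definition KSgq :: "('f, 'p) rule set" where
  "KSgq = {i_down, switch, w_down, c_down, u_down, n_down}"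


section \<open>Derivations, proofs and admissibility\<close>

text \<open>A derivation is represented by the list of its structures, from the premise down to the
  conclusion. Equivalent structures are not distinguished, so rules apply modulo \<open>\<simeq>\<close>.\<close>

definition derivation ::
  "('f \<times> nat) set \<Rightarrow> ('p \<times> nat) set \<Rightarrow> ('f, 'p) rule set \<Rightarrow> ('f, 'p) struct list \<Rightarrow> bool" where
  "derivation F P \<S> Ds \<longleftrightarrow>
     Ds \<noteq> [] \<and> (\<forall>R\<in>set Ds. wf_struct F P R) \<and>
     successively (\<lambda>R T. \<exists>\<rho>\<in>\<S>. ((\<simeq>) OO \<rho> OO (\<simeq>)) R T) Ds"

definition proof_of ::
  "('f \<times> nat) set \<Rightarrow> ('p \<times> nat) set \<Rightarrow> ('f, 'p) rule set \<Rightarrow>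
     ('f, 'p) struct \<Rightarrow> ('f, 'p) struct list \<Rightarrow> bool" where
  "proof_of F P \<S> R Ds \<longleftrightarrow> derivation F P \<S> Ds \<and> hd Ds \<simeq> TT \<and> last Ds \<simeq> R"

definition admissible ::
  "('f \<times> nat) set \<Rightarrow> ('p \<times> nat) set \<Rightarrow> ('f, 'p) rule \<Rightarrow> ('f, 'p) rule set \<Rightarrow> bool" where
  "admissible F P \<rho> \<S> \<longleftrightarrow>
     (\<forall>R Ds. proof_of F P (\<S> \<union> {\<rho>}) R Ds \<longrightarrow> (\<exists>Ds'. proof_of F P \<S> R Ds'))"

end

theory Submission
  imports Defs "HOL-Library.Countable_Set"
begin

text \<open>All rules, including the five up-rules, are sound for Tarski semantics, so it suffices that
  \<open>KSgq\<close> is complete. Rules of a cut-free one-sided sequent calculus are derivable in \<open>KSgq\<close>, with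
  a sequent read as the disjunction of its members. A fair proof search that starts from an unprovable
  structure keeps the sequents unprovable, hence it has an infinite branch. On that branch every
  formula is decomposed and no two complementary literals meet, so declaring its literals false
  defines a countermodel on the terms.\<close>

section \<open>Semantics and soundness\<close>

text \<open>The semantic route settles all five rules at once: nothing about an up-rule is used
  beyond its soundness, whereas permuting cuts would have to follow rules that act at any depth and
  modulo \<open>\<simeq>\<close>. HOL cannot quantify over domain types inside a formula, so one
  domain is fixed. It is \<open>nat\<close>, the domain of the countermodel. The obstacle that
  shapes the search is substitution: \<open>subst\<close> renames nothing, so the variables of a
  witness could be captured. The search therefore never substitutes into a formula. It keeps a
  formula together with a pending substitution, and the pair becomes a structure only when
  provability is discussed, with bound variables named upwards from a level that exceeds all
  variables in use. Eigenvariables force this level to grow along a branch, so it must not matter up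
  to \<open>\<simeq>\<close> which level is taken; \<open>inst_level\<close> says so.\<close>

fun eval_trm :: "('f \<Rightarrow> 'd list \<Rightarrow> 'd) \<Rightarrow> (nat \<Rightarrow> 'd) \<Rightarrow> 'f trm \<Rightarrow> 'd" where
  "eval_trm I v (Var x) = v x"
| "eval_trm I v (Fun f ts) = I f (map (eval_trm I v) ts)"

fun eval_atom ::
  "('f \<Rightarrow> 'd list \<Rightarrow> 'd) \<Rightarrow> ('p \<Rightarrow> 'd list \<Rightarrow> bool) \<Rightarrow> (nat \<Rightarrow> 'd) \<Rightarrow> ('f, 'p) atom \<Rightarrow> bool" where
  "eval_atom I Q v (Pos p ts) \<longleftrightarrow> Q p (map (eval_trm I v) ts)"
| "eval_atom I Q v (Neg p ts) \<longleftrightarrow> \<not> Q p (map (eval_trm I v) ts)"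

fun eval_struct ::
  "('f \<Rightarrow> 'd list \<Rightarrow> 'd) \<Rightarrow> ('p \<Rightarrow> 'd list \<Rightarrow> bool) \<Rightarrow> (nat \<Rightarrow> 'd) \<Rightarrow> ('f, 'p) struct \<Rightarrow> bool" where
  "eval_struct I Q v FF \<longleftrightarrow> False"
| "eval_struct I Q v TT \<longleftrightarrow> True"
| "eval_struct I Q v (Atm a) \<longleftrightarrow> eval_atom I Q v a"
| "eval_struct I Q v (Dis Rs) \<longleftrightarrow> (\<exists>R\<in>set Rs. eval_struct I Q v R)"
| "eval_struct I Q v (Con Rs) \<longleftrightarrow> (\<forall>R\<in>set Rs. eval_struct I Q v R)"
| "eval_struct I Q v (Bar R) \<longleftrightarrow> \<not> eval_struct I Q v R"
| "eval_struct I Q v (Exi x R) \<longleftrightarrow> (\<exists>d. eval_struct I Q (v(x := d)) R)"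
| "eval_struct I Q v (Uni x R) \<longleftrightarrow> (\<forall>d. eval_struct I Q (v(x := d)) R)"

lemma eval_trm_cong: "(\<And>x. x \<in> vars_trm t \<Longrightarrow> v x = w x) \<Longrightarrow> eval_trm I v t = eval_trm I w t"
proof (induction t)
  case (Fun f ts)
  then have "map (eval_trm I v) ts = map (eval_trm I w) ts" by (intro map_cong) auto
  then show ?case by (simp only: eval_trm.simps)
qed simp

lemma eval_atom_cong: "(\<And>x. x \<in> vars_atom a \<Longrightarrow> v x = w x) \<Longrightarrow> eval_atom I Q v a = eval_atom I Q w a"
proof (cases a)
  case (Pos p ts)
  assume "\<And>x. x \<in> vars_atom a \<Longrightarrow> v x = w x"
  then have "map (eval_trm I v) ts = map (eval_trm I w) ts"
    by (intro map_cong refl eval_trm_cong) (auto simp: Pos)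
  then show ?thesis by (simp only: Pos eval_atom.simps)
next
  case (Neg p ts)
  assume "\<And>x. x \<in> vars_atom a \<Longrightarrow> v x = w x"
  then have "map (eval_trm I v) ts = map (eval_trm I w) ts"
    by (intro map_cong refl eval_trm_cong) (auto simp: Neg)
  then show ?thesis by (simp only: Neg eval_atom.simps)
qed

lemma eval_struct_cong:
  "(\<And>x. x \<in> fv R \<Longrightarrow> v x = w x) \<Longrightarrow> eval_struct I Q v R = eval_struct I Q w R"
proof (induction R arbitrary: v w)
  case (Atm a)
  then show ?case by (simp only: eval_struct.simps fv.simps) (rule eval_atom_cong)
next
  case (Dis Rs)
  have "eval_struct I Q v R = eval_struct I Q w R" if "R \<in> set Rs" for R
    by (rule Dis.IH[OF that], rule Dis.prems) (use that in auto)
  then show ?case by simp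
next
  case (Con Rs)
  have "eval_struct I Q v R = eval_struct I Q w R" if "R \<in> set Rs" for R
    by (rule Con.IH[OF that], rule Con.prems) (use that in auto)
  then show ?case by simp
next
  case (Bar R)
  have "eval_struct I Q v R = eval_struct I Q w R" by (rule Bar.IH) (simp add: Bar.prems)
  then show ?case by simp
next
  case (Exi x R)
  have "eval_struct I Q (v(x := d)) R = eval_struct I Q (w(x := d)) R" for d
    by (rule Exi.IH) (simp add: Exi.prems)
  then show ?case by simp
next
  case (Uni x R)
  have "eval_struct I Q (v(x := d)) R = eval_struct I Q (w(x := d)) R" for d
    by (rule Uni.IH) (simp add: Uni.prems)
  then show ?case by simp
qed simp_all

lemma eval_subst_trm: "eval_trm I v (subst_trm x t s) = eval_trm I (v(x := eval_trm I v t)) s"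
  by (induction s) (auto simp: o_def cong: map_cong)

lemma eval_subst_atom:
  "eval_atom I Q v (subst_atom x t a) = eval_atom I Q (v(x := eval_trm I v t)) a"
  by (cases a) (simp_all add: o_def eval_subst_trm)

lemma subst_notin_fv_trm: "x \<notin> vars_trm s \<Longrightarrow> subst_trm x t s = s"
  by (induction s) (auto simp: map_idI)

lemma subst_notin_fv_atom: "x \<notin> vars_atom a \<Longrightarrow> subst_atom x t a = a"
  by (cases a) (auto simp: subst_notin_fv_trm intro!: map_idI)

lemma subst_notin_fv: "x \<notin> fv R \<Longrightarrow> subst x t R = R"
  by (induction R) (auto simp: subst_notin_fv_atom intro!: map_idI)

text \<open>A binder \<open>y\<close> may occur in \<open>t\<close> only if \<open>x\<close> is not
  free below it. In that case the substitution changes nothing and the value of \<open>x\<close> is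
  irrelevant; otherwise the updates at \<open>x\<close> and \<open>y\<close> commute and leave the
  value of \<open>t\<close> unchanged.\<close>

lemma eval_subst:
  "free_for t x R \<Longrightarrow> eval_struct I Q v (subst x t R) = eval_struct I Q (v(x := eval_trm I v t)) R"
proof (induction R arbitrary: v)
  case (Exi y R)
  show ?case
  proof (cases "x \<in> fv (Exi y R)")
    case True
    then have y: "y \<noteq> x" "y \<notin> vars_trm t" "free_for t x R" using Exi.prems by auto
    have "eval_trm I (v(y := d)) t = eval_trm I v t" for d
      using y by (intro eval_trm_cong) auto
    then have "eval_struct I Q (v(y := d)) (subst x t R)
        = eval_struct I Q (v(x := eval_trm I v t, y := d)) R" for d
      using y by (simp only: Exi.IH fun_upd_twist[OF y(1)])
    then show ?thesis using y(1) by (simp only: subst.simps eval_struct.simps if_False)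
  next
    case False
    have "eval_struct I Q v (Exi y R) = eval_struct I Q (v(x := eval_trm I v t)) (Exi y R)"
      using False by (intro eval_struct_cong) auto
    then show ?thesis by (simp only: subst_notin_fv[OF False])
  qed
next
  case (Uni y R)
  show ?case
  proof (cases "x \<in> fv (Uni y R)")
    case True
    then have y: "y \<noteq> x" "y \<notin> vars_trm t" "free_for t x R" using Uni.prems by auto
    have "eval_trm I (v(y := d)) t = eval_trm I v t" for d
      using y by (intro eval_trm_cong) auto
    then have "eval_struct I Q (v(y := d)) (subst x t R)
        = eval_struct I Q (v(x := eval_trm I v t, y := d)) R" for d
      using y by (simp only: Uni.IH fun_upd_twist[OF y(1)])
    then show ?thesis using y(1) by (simp only: subst.simps eval_struct.simps if_False)
  next
    case False
    have "eval_struct I Q v (Uni y R) = eval_struct I Q (v(x := eval_trm I v t)) (Uni y R)"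
      using False by (intro eval_struct_cong) auto
    then show ?thesis by (simp only: subst_notin_fv[OF False])
  qed
qed (auto simp: eval_subst_atom)

text \<open>Contexts contain no negation around the hole, so truth is monotone in it. The hypothesis
  ranges over all valuations because quantifiers of \<open>S\<close> change the valuation.\<close>

lemma eval_fill_mono:
  assumes "\<And>v. eval_struct I Q v R \<Longrightarrow> eval_struct I Q v T"
  shows "eval_struct I Q v (fill S R) \<Longrightarrow> eval_struct I Q v (fill S T)"
proof (induction S arbitrary: v)
  case Hole
  then show ?case using assms by simp
next
  case (CExi x S)
  then show ?case by (simp only: fill.simps eval_struct.simps) blast
next
  case (CUni x S)
  then show ?case by (simp only: fill.simps eval_struct.simps) blast
qed auto

lemma eval_rename:
  assumes "y \<notin> fv R" "free_for (Var y) x R"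
  shows "eval_struct I Q (v(y := d)) (subst x (Var y) R) = eval_struct I Q (v(x := d)) R"
proof -
  have "eval_struct I Q (v(y := d)) (subst x (Var y) R) = eval_struct I Q (v(y := d, x := d)) R"
    by (simp add: eval_subst[OF assms(2)])
  also have "\<dots> = eval_struct I Q (v(x := d)) R"
    using assms(1) by (intro eval_struct_cong) auto
  finally show ?thesis .
qed

lemma eval_vacuous: "y \<notin> fv R \<Longrightarrow> eval_struct I Q (v(y := d)) R = eval_struct I Q v R"
  by (rule eval_struct_cong) auto

lemma eval_neg_atom: "eval_atom I Q v (neg_atom a) = (\<not> eval_atom I Q v a)"
  by (cases a) simp_all

text \<open>The vacuous quantifier laws hold because domains are HOL types and hence
  non-empty.\<close>

lemma equiv_sound: "R \<simeq> T \<Longrightarrow> eval_struct I Q v R = eval_struct I Q v T"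
proof (induction arbitrary: v rule: equiv_struct.induct)
  case (ctxt_closure R T S)
  have RT: "eval_struct I Q v T" if "eval_struct I Q v R" for v
    using ctxt_closure.IH that by simp
  have TR: "eval_struct I Q v R" if "eval_struct I Q v T" for v
    using ctxt_closure.IH that by simp
  show ?case
    using eval_fill_mono[of I Q R T, OF RT] eval_fill_mono[of I Q T R, OF TR] by blast
next
  case (sym R T)
  show ?case by (rule sym.IH[symmetric])
next
  case (trans R T U)
  show ?case by (rule HOL.trans[OF trans.IH])
next
  case (rename_uni y R x)
  show ?case by (simp only: eval_struct.simps eval_rename[OF rename_uni])
next
  case (rename_exi y R x)
  show ?case by (simp only: eval_struct.simps eval_rename[OF rename_exi])
next
  case (vacuous_uni y R)
  show ?case by (simp only: eval_struct.simps eval_vacuous[OF vacuous_uni]) simp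
next
  case (vacuous_exi y R)
  show ?case by (simp only: eval_struct.simps eval_vacuous[OF vacuous_exi]) simp
qed (auto simp: eval_neg_atom)

section \<open>Soundness of the individual rules and of proofs\<close>

text \<open>The domain type occurs only under the quantifiers of the body, so it has to be passed as
  an \<open>itself\<close> argument.\<close>

definition sound :: "('f, 'p) rule \<Rightarrow> 'd itself \<Rightarrow> bool" where
  "sound \<rho> _ \<longleftrightarrow> (\<forall>(I :: 'f \<Rightarrow> 'd list \<Rightarrow> 'd) Q v R T.
     \<rho> R T \<longrightarrow> eval_struct I Q v R \<longrightarrow> eval_struct I Q v T)"

lemma soundI:
  assumes "\<And>R T. \<rho> R T \<Longrightarrow> \<exists>S X Y. R = fill S X \<and> T = fill S Y \<and>
    (\<forall>(I :: 'f \<Rightarrow> 'd list \<Rightarrow> 'd) Q v. eval_struct I Q v X \<longrightarrow> eval_struct I Q v Y)"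
  shows "sound \<rho> TYPE('d)"
  unfolding sound_def
proof (intro allI impI)
  fix I :: "'f \<Rightarrow> 'd list \<Rightarrow> 'd" and Q v R T
  assume "\<rho> R T" and R: "eval_struct I Q v R"
  then obtain S X Y where "R = fill S X" "T = fill S Y"
    and "\<And>v. eval_struct I Q v X \<Longrightarrow> eval_struct I Q v Y"
    using assms by metis
  then show "eval_struct I Q v T" using R eval_fill_mono by blast
qed

lemma sound_i_down: "sound i_down TYPE('d)"
  by (rule soundI, erule i_down.cases, intro exI conjI, assumption, assumption) auto

lemma sound_i_up: "sound i_up TYPE('d)"
  by (rule soundI, erule i_up.cases, intro exI conjI, assumption, assumption) auto

lemma sound_switch: "sound switch TYPE('d)"
  by (rule soundI, erule switch.cases, intro exI conjI, assumption, assumption) auto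

lemma sound_w_down: "sound w_down TYPE('d)"
  by (rule soundI, erule w_down.cases, intro exI conjI, assumption, assumption) auto

lemma sound_w_up: "sound w_up TYPE('d)"
  by (rule soundI, erule w_up.cases, intro exI conjI, assumption, assumption) auto

lemma sound_c_down: "sound c_down TYPE('d)"
  by (rule soundI, erule c_down.cases, intro exI conjI, assumption, assumption) auto

lemma sound_c_up: "sound c_up TYPE('d)"
  by (rule soundI, erule c_up.cases, intro exI conjI, assumption, assumption) auto

lemma sound_u_down: "sound u_down TYPE('d)"
  by (rule soundI, erule u_down.cases, intro exI conjI, assumption, assumption) auto

lemma sound_u_up: "sound u_up TYPE('d)"
  by (rule soundI, erule u_up.cases, intro exI conjI, assumption, assumption) auto

lemma sound_n_down: "sound n_down TYPE('d)"
  by (rule soundI, erule n_down.cases, intro exI conjI, assumption, assumption) (auto simp: eval_subst)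

lemma sound_n_up: "sound n_up TYPE('d)"
  by (rule soundI, erule n_up.cases, intro exI conjI, assumption, assumption) (auto simp: eval_subst)

lemma sound_KSgq: "\<rho> \<in> KSgq \<Longrightarrow> sound \<rho> TYPE('d)"
  unfolding KSgq_def
  using sound_i_down sound_switch sound_w_down sound_c_down sound_u_down sound_n_down by blast

lemma proof_sound:
  fixes I :: "'f \<Rightarrow> 'd list \<Rightarrow> 'd"
  assumes "proof_of F P \<S> R Ds" and "\<And>\<rho>. \<rho> \<in> \<S> \<Longrightarrow> sound \<rho> TYPE('d)"
  shows "eval_struct I Q v R"
proof -
  have "eval_struct I Q v (last Ds)"
    if "Ds \<noteq> []" "successively (\<lambda>R T. \<exists>\<rho>\<in>\<S>. ((\<simeq>) OO \<rho> OO (\<simeq>)) R T) Ds"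
      "eval_struct I Q v (hd Ds)" for Ds
    using that
  proof (induction Ds rule: induct_list012)
    case (3 R T Ds)
    then obtain \<rho> R' T' where "\<rho> \<in> \<S>" "R \<simeq> R'" "\<rho> R' T'" "T' \<simeq> T" by auto
    then have "eval_struct I Q v T"
      using 3(5) assms(2)[of \<rho>] equiv_sound by (fastforce simp: sound_def)
    then show ?case using 3 by simp
  qed simp_all
  moreover have "eval_struct I Q v (hd Ds)"
    using assms(1) by (simp add: proof_of_def equiv_sound[of "hd Ds" TT])
  ultimately have "eval_struct I Q v (last Ds)"
    using assms(1) by (simp add: proof_of_def derivation_def)
  then show ?thesis using assms(1) by (simp add: proof_of_def equiv_sound[of "last Ds" R])
qed

section \<open>Provability in \<open>KSgq\<close>\<close>

text \<open>The list built from such a proof consists of \<open>TT\<close> and the rule conclusions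
  \<open>T\<close>, so only the latter must be well-formed. Equivalence is absorbed into
  \<open>base\<close> and after each step.\<close>

inductive prov ::
  "('f \<times> nat) set \<Rightarrow> ('p \<times> nat) set \<Rightarrow> ('f, 'p) struct \<Rightarrow> bool" for F P where
  base: "R \<simeq> TT \<Longrightarrow> prov F P R"
| step: "prov F P R \<Longrightarrow> \<rho> \<in> KSgq \<Longrightarrow> \<rho> R T \<Longrightarrow> wf_struct F P T \<Longrightarrow> T \<simeq> U \<Longrightarrow> prov F P U"

lemma prov_equiv: "prov F P R \<Longrightarrow> R \<simeq> T \<Longrightarrow> prov F P T"
proof (induction rule: prov.induct)
  case (base R)
  then show ?case by (blast intro: prov.base equiv_struct.sym equiv_struct.trans)
next
  case (step R \<rho> S U)
  then show ?case by (blast intro: prov.step equiv_struct.trans)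
qed

lemma prov_rule: "prov F P R \<Longrightarrow> \<rho> \<in> KSgq \<Longrightarrow> \<rho> R T \<Longrightarrow> wf_struct F P T \<Longrightarrow> prov F P T"
  using prov.step equiv_struct.refl by blast

text \<open>No converse is called for: given proofs enter the argument only through their
  semantics.\<close>

lemma prov_imp_proof: "prov F P R \<Longrightarrow> \<exists>Ds. proof_of F P KSgq R Ds"
proof (induction rule: prov.induct)
  case (base R)
  then have "proof_of F P KSgq R [TT]"
    by (simp add: proof_of_def derivation_def equiv_struct.refl equiv_struct.sym)
  then show ?case by blast
next
  case (step R \<rho> T U)
  then obtain Ds where Ds: "proof_of F P KSgq R Ds" by blast
  have "((\<simeq>) OO \<rho> OO (\<simeq>)) (last Ds) T"
    using Ds step.hyps(3) equiv_struct.refl unfolding proof_of_def by blast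
  then have "proof_of F P KSgq U (Ds @ [T])"
    using Ds step.hyps by (auto simp: proof_of_def derivation_def successively_append_iff)
  then show ?case by blast
qed

primrec ctxt_comp :: "('f, 'p) ctxt \<Rightarrow> ('f, 'p) ctxt \<Rightarrow> ('f, 'p) ctxt" where
  "ctxt_comp Hole S' = S'"
| "ctxt_comp (CDis Rs S Us) S' = CDis Rs (ctxt_comp S S') Us"
| "ctxt_comp (CCon Rs S Us) S' = CCon Rs (ctxt_comp S S') Us"
| "ctxt_comp (CExi x S) S' = CExi x (ctxt_comp S S')"
| "ctxt_comp (CUni x S) S' = CUni x (ctxt_comp S S')"

lemma fill_ctxt_comp: "fill S (fill S' R) = fill (ctxt_comp S S') R"
  by (induction S) simp_all

lemma KSgq_fill: "\<rho> \<in> KSgq \<Longrightarrow> \<rho> R T \<Longrightarrow> \<rho> (fill S R) (fill S T)"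
  unfolding KSgq_def
  by (auto elim!: i_down.cases switch.cases w_down.cases c_down.cases u_down.cases n_down.cases
      simp: fill_ctxt_comp
      intro: i_down.intros switch.intros w_down.intros c_down.intros u_down.intros n_down.intros)

lemma wf_fill: "wf_struct F P (fill S R) \<Longrightarrow> wf_struct F P T \<Longrightarrow> wf_struct F P (fill S T)"
  by (induction S) auto

text \<open>Rules apply at any depth, so a proof of \<open>R\<close> can be replayed inside
  \<open>S\<close>. This replaces the branching of sequent proofs: two proofs run one after the
  other inside a conjunction.\<close>

lemma prov_fill:
  "prov F P R \<Longrightarrow> prov F P (fill S TT) \<Longrightarrow> wf_struct F P (fill S TT) \<Longrightarrow> prov F P (fill S R)"
proof (induction rule: prov.induct)
  case (base R)
  then show ?case by (blast intro: prov_equiv equiv_struct.ctxt_closure equiv_struct.sym)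
next
  case (step R \<rho> T U)
  then show ?case
    by (blast intro: prov.step KSgq_fill wf_fill equiv_struct.ctxt_closure)
qed

section \<open>Derived laws of the equivalence\<close>

lemma equiv_Dis: "R \<simeq> R' \<Longrightarrow> T \<simeq> T' \<Longrightarrow> Dis [R, T] \<simeq> Dis [R', T']"
  using ctxt_closure[of R R' "CDis [] Hole [T]"] ctxt_closure[of T T' "CDis [R'] Hole []"]
  by (auto intro: equiv_struct.trans)

lemma equiv_Con: "R \<simeq> R' \<Longrightarrow> T \<simeq> T' \<Longrightarrow> Con [R, T] \<simeq> Con [R', T']"
  using ctxt_closure[of R R' "CCon [] Hole [T]"] ctxt_closure[of T T' "CCon [R'] Hole []"]
  by (auto intro: equiv_struct.trans)

lemma equiv_Exi: "R \<simeq> R' \<Longrightarrow> Exi x R \<simeq> Exi x R'"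
  using ctxt_closure[of R R' "CExi x Hole"] by simp

lemma equiv_Uni: "R \<simeq> R' \<Longrightarrow> Uni x R \<simeq> Uni x R'"
  using ctxt_closure[of R R' "CUni x Hole"] by simp

lemma equiv_Dis_Cons: "Rs \<noteq> [] \<Longrightarrow> Dis (R # Rs) \<simeq> Dis [R, Dis Rs]"
  using assoc_dis[of Rs "[R]" "[]"] by (simp add: equiv_struct.sym)

lemma equiv_Con_Cons: "Rs \<noteq> [] \<Longrightarrow> Con (R # Rs) \<simeq> Con [R, Con Rs]"
  using assoc_con[of Rs "[R]" "[]"] by (simp add: equiv_struct.sym)

lemma equiv_Dis_assoc: "Dis [Dis [R, T], U] \<simeq> Dis [R, Dis [T, U]]"
  using assoc_dis[of "[R, T]" "[]" "[U]"] assoc_dis[of "[T, U]" "[R]" "[]"]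
  by (auto intro: equiv_struct.trans equiv_struct.sym)

lemma equiv_Dis_FF: "Dis [R, FF] \<simeq> R"
  using comm_dis[of R FF] dis_FF[of R] equiv_struct.trans by blast

lemma equiv_Con_TT: "Con [R, TT] \<simeq> R"
  using comm_con[of R TT] con_TT[of R] equiv_struct.trans by blast

text \<open>\<open>[R] = R\<close> is not among the axioms; it follows from associativity and the unit law.\<close>

lemma equiv_Dis_single: "Dis [R] \<simeq> R"
proof -
  have "Dis [Dis [FF, R]] \<simeq> Dis [FF, R]" using assoc_dis[of "[FF, R]" "[]" "[]"] by simp
  moreover have "Dis [Dis [FF, R]] \<simeq> Dis [R]"
    using ctxt_closure[OF dis_FF[of R], of "CDis [] Hole []"] by simp
  ultimately show ?thesis using dis_FF[of R] by (meson equiv_struct.sym equiv_struct.trans)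
qed

lemma equiv_Con_single: "Con [R] \<simeq> R"
proof -
  have "Con [Con [TT, R]] \<simeq> Con [TT, R]" using assoc_con[of "[TT, R]" "[]" "[]"] by simp
  moreover have "Con [Con [TT, R]] \<simeq> Con [R]"
    using ctxt_closure[OF con_TT[of R], of "CCon [] Hole []"] by simp
  ultimately show ?thesis using con_TT[of R] by (meson equiv_struct.sym equiv_struct.trans)
qed

text \<open>Commutativity, units and De Morgan laws are axioms for two-element lists only. Binary
  nesting ending in the unit makes them applicable and also gives the empty list a meaning.\<close>

definition dis_list :: "('f, 'p) struct list \<Rightarrow> ('f, 'p) struct" where
  "dis_list Rs = foldr (\<lambda>R T. Dis [R, T]) Rs FF"

definition con_list :: "('f, 'p) struct list \<Rightarrow> ('f, 'p) struct" where
  "con_list Rs = foldr (\<lambda>R T. Con [R, T]) Rs TT"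

lemma dis_list_simps [simp]: "dis_list [] = FF" "dis_list (R # Rs) = Dis [R, dis_list Rs]"
  by (simp_all add: dis_list_def)

lemma con_list_simps [simp]: "con_list [] = TT" "con_list (R # Rs) = Con [R, con_list Rs]"
  by (simp_all add: con_list_def)

lemma equiv_Dis_disj: "Rs \<noteq> [] \<Longrightarrow> Dis Rs \<simeq> dis_list Rs"
proof (induction Rs rule: induct_list012)
  case (2 R)
  have "Dis [R] \<simeq> Dis [R, FF]"
    using equiv_Dis_single equiv_Dis_FF by (blast intro: equiv_struct.trans equiv_struct.sym)
  then show ?case by simp
next
  case (3 R T Rs)
  have "Dis (R # T # Rs) \<simeq> Dis [R, Dis (T # Rs)]" by (simp add: equiv_Dis_Cons)
  moreover have "Dis [R, Dis (T # Rs)] \<simeq> Dis [R, dis_list (T # Rs)]"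
    using 3 by (intro equiv_Dis equiv_struct.refl) simp
  ultimately show ?case by (metis dis_list_simps(2) equiv_struct.trans)
qed simp

lemma equiv_Con_conj: "Rs \<noteq> [] \<Longrightarrow> Con Rs \<simeq> con_list Rs"
proof (induction Rs rule: induct_list012)
  case (2 R)
  have "Con [R] \<simeq> Con [R, TT]"
    using equiv_Con_single equiv_Con_TT by (blast intro: equiv_struct.trans equiv_struct.sym)
  then show ?case by simp
next
  case (3 R T Rs)
  have "Con (R # T # Rs) \<simeq> Con [R, Con (T # Rs)]" by (simp add: equiv_Con_Cons)
  moreover have "Con [R, Con (T # Rs)] \<simeq> Con [R, con_list (T # Rs)]"
    using 3 by (intro equiv_Con equiv_struct.refl) simp
  ultimately show ?case by (metis con_list_simps(2) equiv_struct.trans)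
qed simp

lemma equiv_Bar_disj: "Bar (dis_list Rs) \<simeq> con_list (map Bar Rs)"
proof (induction Rs)
  case (Cons R Rs)
  then have "Con [Bar R, Bar (dis_list Rs)] \<simeq> Con [Bar R, con_list (map Bar Rs)]"
    by (intro equiv_Con equiv_struct.refl)
  then show ?case using bar_dis[of R "dis_list Rs"] by (auto intro: equiv_struct.trans)
qed (simp add: bar_FF)

lemma equiv_Bar_conj: "Bar (con_list Rs) \<simeq> dis_list (map Bar Rs)"
proof (induction Rs)
  case (Cons R Rs)
  then have "Dis [Bar R, Bar (con_list Rs)] \<simeq> Dis [Bar R, dis_list (map Bar Rs)]"
    by (intro equiv_Dis equiv_struct.refl)
  then show ?case using bar_con[of R "con_list Rs"] by (auto intro: equiv_struct.trans)
qed (simp add: bar_TT)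

lemma equiv_disj_cong: "list_all2 (\<simeq>) Rs Ts \<Longrightarrow> dis_list Rs \<simeq> dis_list Ts"
  by (induction rule: list_all2_induct) (auto intro: equiv_struct.refl equiv_Dis)

lemma equiv_conj_cong: "list_all2 (\<simeq>) Rs Ts \<Longrightarrow> con_list Rs \<simeq> con_list Ts"
  by (induction rule: list_all2_induct) (auto intro: equiv_struct.refl equiv_Con)

lemma equiv_disj_append: "dis_list (Rs @ Ts) \<simeq> Dis [dis_list Rs, dis_list Ts]"
proof (induction Rs)
  case Nil
  then show ?case by (simp add: dis_FF equiv_struct.sym)
next
  case (Cons R Rs)
  have "Dis [R, dis_list (Rs @ Ts)] \<simeq> Dis [R, Dis [dis_list Rs, dis_list Ts]]"
    by (rule equiv_Dis[OF equiv_struct.refl Cons.IH])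
  then show ?case
    using equiv_Dis_assoc[of R "dis_list Rs" "dis_list Ts"]
    by (auto intro: equiv_struct.trans equiv_struct.sym)
qed

lemma equiv_disj_rotate: "dis_list (Rs @ Ts) \<simeq> dis_list (Ts @ Rs)"
  using equiv_disj_append[of Rs Ts] equiv_disj_append[of Ts Rs] comm_dis[of "dis_list Rs" "dis_list Ts"]
  by (blast intro: equiv_struct.trans equiv_struct.sym)

lemma wf_disj: "wf_struct F P (dis_list Rs) \<longleftrightarrow> (\<forall>R\<in>set Rs. wf_struct F P R)"
  by (induction Rs) auto

section \<open>Sequent rules derived in \<open>KSgq\<close>\<close>

lemma prov_weaken:
  assumes "prov F P G" "wf_struct F P A" "wf_struct F P G"
  shows "prov F P (Dis [A, G])"
proof -
  have "prov F P (Dis [FF, G])"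
    using assms(1) dis_FF equiv_struct.sym prov_equiv by blast
  moreover have "w_down (Dis [FF, G]) (Dis [A, G])"
    using w_down.intros[of "CDis [] Hole [G]" A] by simp
  ultimately show ?thesis using assms by (auto intro: prov_rule simp: KSgq_def)
qed

lemma equiv_disj_member:
  assumes "A \<in> set Rs"
  obtains Ts where "dis_list Rs \<simeq> Dis [A, dis_list Ts]" "set Ts \<subseteq> set Rs" "set Rs \<subseteq> insert A (set Ts)"
proof -
  obtain Us Vs where "Rs = Us @ A # Vs" using assms by (meson split_list)
  then show ?thesis using that[of "Vs @ Us"] equiv_disj_rotate[of Us "A # Vs"] by auto
qed

lemma prov_disj_member:
  assumes "prov F P A" "A \<in> set Rs" "\<forall>R\<in>set Rs. wf_struct F P R"
  shows "prov F P (dis_list Rs)"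
proof -
  obtain Ts where Ts: "dis_list Rs \<simeq> Dis [A, dis_list Ts]" "set Ts \<subseteq> set Rs"
    using equiv_disj_member[OF assms(2)] by blast
  have "prov F P (Dis [dis_list Ts, A])"
    using assms Ts by (intro prov_weaken) (auto simp: wf_disj)
  then show ?thesis
    using Ts(1) by (blast intro: prov_equiv comm_dis equiv_struct.sym equiv_struct.trans)
qed

lemma prov_disj_member2:
  assumes "prov F P (Dis [A, B])" "A \<in> set Rs" "B \<in> set Rs" "A \<noteq> B"
    "\<forall>R\<in>set Rs. wf_struct F P R"
  shows "prov F P (dis_list Rs)"
proof -
  obtain Ts where Ts: "dis_list Rs \<simeq> Dis [A, dis_list Ts]" "set Ts \<subseteq> set Rs" "set Rs \<subseteq> insert A (set Ts)"
    using equiv_disj_member[OF assms(2)] by blast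
  \<comment> \<open>\<open>A \<noteq> B\<close> ensures that \<open>B\<close> is still among the
    members left after \<open>A\<close> has been split off.\<close>
  then have "B \<in> set Ts" using assms by blast
  then obtain Us where Us: "dis_list Ts \<simeq> Dis [B, dis_list Us]" "set Us \<subseteq> set Ts"
    using equiv_disj_member by blast
  have "prov F P (Dis [dis_list Us, Dis [A, B]])"
    using assms Ts(2) Us(2) by (intro prov_weaken[of _ _ "Dis [A, B]"]) (auto simp: wf_disj)
  moreover have "Dis [dis_list Us, Dis [A, B]] \<simeq> Dis [A, Dis [B, dis_list Us]]"
    by (blast intro: comm_dis equiv_Dis_assoc equiv_struct.trans)
  moreover have "Dis [A, Dis [B, dis_list Us]] \<simeq> dis_list Rs"
    using equiv_Dis[OF equiv_struct.refl Us(1)] Ts(1)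
    by (blast intro: equiv_struct.trans equiv_struct.sym)
  ultimately show ?thesis using prov_equiv by blast
qed

lemma prov_axiom:
  assumes "wf_struct F P A" "A' \<simeq> Bar A" "wf_struct F P A'"
  shows "prov F P (Dis [A, A'])"
proof -
  have "i_down TT (Dis [A, Bar A])"
    using i_down.intros[of Hole A] by simp
  then have "prov F P (Dis [A, Bar A])"
    using assms by (intro prov_rule[OF prov.base[OF equiv_struct.refl], of i_down])
      (simp_all add: KSgq_def)
  then show ?thesis
    using equiv_Dis[OF equiv_struct.refl equiv_struct.sym[OF assms(2)]] prov_equiv by blast
qed

text \<open>The two proofs are put side by side in a conjunction. Two switches, with a commutation
  in between, move both copies of \<open>G\<close> out of it, and contraction merges them.\<close>

lemma prov_Con:
  assumes "prov F P (Dis [A, G])" "prov F P (Dis [B, G])"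
    and wf: "wf_struct F P A" "wf_struct F P B" "wf_struct F P G"
  shows "prov F P (Dis [Con [A, B], G])"
proof -
  let ?A = "Dis [A, G]" and ?B = "Dis [B, G]"
  have "prov F P (Con [TT, TT])" by (simp add: prov.base con_TT)
  then have "prov F P (Con [?A, TT])"
    using prov_fill[OF assms(1), of "CCon [] Hole [TT]"] by simp
  then have "prov F P (Con [?A, ?B])"
    using prov_fill[OF assms(2), of "CCon [?A] Hole []"] wf by simp
  moreover have "switch (Con [?A, ?B]) (Dis [Con [A, ?B], G])"
    using switch.intros[of Hole A G ?B] by simp
  ultimately have "prov F P (Dis [Con [A, ?B], G])"
    using wf by (auto intro: prov_rule simp: KSgq_def)
  moreover have "Dis [Con [A, ?B], G] \<simeq> Dis [Con [?B, A], G]"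
    by (rule equiv_Dis[OF comm_con equiv_struct.refl])
  ultimately have "prov F P (Dis [Con [?B, A], G])" using prov_equiv by blast
  moreover have "switch (Dis [Con [?B, A], G]) (Dis [Dis [Con [B, A], G], G])"
    using switch.intros[of "CDis [] Hole [G]" B G A] by simp
  ultimately have "prov F P (Dis [Dis [Con [B, A], G], G])"
    using wf by (auto intro: prov_rule simp: KSgq_def)
  then have "prov F P (Dis [Con [B, A], Dis [G, G]])"
    using equiv_Dis_assoc prov_equiv by blast
  moreover have "c_down (Dis [Con [B, A], Dis [G, G]]) (Dis [Con [B, A], G])"
    using c_down.intros[of "CDis [Con [B, A]] Hole []" G] by simp
  ultimately have "prov F P (Dis [Con [B, A], G])"
    using wf by (auto intro: prov_rule simp: KSgq_def)
  then show ?thesis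
    using equiv_Dis[OF comm_con equiv_struct.refl] prov_equiv by blast
qed

text \<open>Contraction keeps the existential structure beside its instance, so that further
  witnesses remain available.\<close>

lemma prov_Exi:
  assumes "prov F P (Dis [subst x t A, Dis [Exi x A, G]])" "free_for t x A"
    and wf: "wf_struct F P A" "wf_struct F P G"
  shows "prov F P (Dis [Exi x A, G])"
proof -
  have "n_down (Dis [subst x t A, Dis [Exi x A, G]]) (Dis [Exi x A, Dis [Exi x A, G]])"
    using n_down.intros[OF assms(2), of "CDis [] Hole [Dis [Exi x A, G]]"] by simp
  then have "prov F P (Dis [Exi x A, Dis [Exi x A, G]])"
    using assms by (auto intro: prov_rule simp: KSgq_def)
  then have "prov F P (Dis [Dis [Exi x A, Exi x A], G])"
    using equiv_Dis_assoc equiv_struct.sym prov_equiv by blast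
  moreover have "c_down (Dis [Dis [Exi x A, Exi x A], G]) (Dis [Exi x A, G])"
    using c_down.intros[of "CDis [] Hole [G]" "Exi x A"] by simp
  ultimately show ?thesis using wf by (auto intro: prov_rule simp: KSgq_def)
qed

text \<open>The given proof is replayed below the quantifier, starting from \<open>Uni x TT\<close>,
  which is vacuous. After \<open>u_down\<close> the quantifier on \<open>G\<close> is vacuous as
  well.\<close>

lemma prov_Uni:
  assumes "prov F P (Dis [A, G])" "x \<notin> fv G"
    and wf: "wf_struct F P A" "wf_struct F P G"
  shows "prov F P (Dis [Uni x A, G])"
proof -
  have "prov F P (Uni x TT)" by (simp add: prov.base vacuous_uni)
  then have "prov F P (Uni x (Dis [A, G]))"
    using prov_fill[OF assms(1), of "CUni x Hole"] by simp
  moreover have "u_down (Uni x (Dis [A, G])) (Dis [Uni x A, Exi x G])"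
    using u_down.intros[of Hole x A G] by simp
  ultimately have "prov F P (Dis [Uni x A, Exi x G])"
    using wf by (auto intro: prov_rule simp: KSgq_def)
  moreover have "Dis [Uni x A, Exi x G] \<simeq> Dis [Uni x A, G]"
    by (rule equiv_Dis[OF equiv_struct.refl vacuous_exi[OF assms(2)]])
  ultimately show ?thesis using prov_equiv by blast
qed

section \<open>Negation normal forms and their instances\<close>

datatype ('f, 'p) fm =
    Fls
  | Tru
  | Lit "('f, 'p) atom"
  | Or "('f, 'p) fm" "('f, 'p) fm"
  | And "('f, 'p) fm" "('f, 'p) fm"
  | Ex nat "('f, 'p) fm"
  | All nat "('f, 'p) fm"

primrec struct_of :: "('f, 'p) fm \<Rightarrow> ('f, 'p) struct" where
  "struct_of Fls = FF"
| "struct_of Tru = TT"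
| "struct_of (Lit a) = Atm a"
| "struct_of (Or a b) = Dis [struct_of a, struct_of b]"
| "struct_of (And a b) = Con [struct_of a, struct_of b]"
| "struct_of (Ex x a) = Exi x (struct_of a)"
| "struct_of (All x a) = Uni x (struct_of a)"

text \<open>Carrying the polarity \<open>c\<close> as an argument keeps the recursion structural
  under \<open>Bar\<close>; \<open>False\<close> yields the negation.\<close>

fun nnf :: "bool \<Rightarrow> ('f, 'p) struct \<Rightarrow> ('f, 'p) fm" where
  "nnf c FF = (if c then Fls else Tru)"
| "nnf c TT = (if c then Tru else Fls)"
| "nnf c (Atm a) = Lit (if c then a else neg_atom a)"
| "nnf c (Dis Rs) = (if c then foldr Or (map (nnf c) Rs) Fls else foldr And (map (nnf c) Rs) Tru)"
| "nnf c (Con Rs) = (if c then foldr And (map (nnf c) Rs) Tru else foldr Or (map (nnf c) Rs) Fls)"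
| "nnf c (Bar R) = nnf (\<not> c) R"
| "nnf c (Exi x R) = (if c then Ex x (nnf c R) else All x (nnf c R))"
| "nnf c (Uni x R) = (if c then All x (nnf c R) else Ex x (nnf c R))"

lemma struct_of_foldr:
  "struct_of (foldr Or as Fls) = dis_list (map struct_of as)"
  "struct_of (foldr And as Tru) = con_list (map struct_of as)"
  by (induction as) simp_all

lemma wf_neg_atom: "wf_atom F P (neg_atom a) = wf_atom F P a"
  by (cases a) simp_all

lemma wf_conj: "wf_struct F P (con_list Rs) \<longleftrightarrow> (\<forall>R\<in>set Rs. wf_struct F P R)"
  by (induction Rs) auto

lemma wf_nnf: "wf_struct F P R \<Longrightarrow> wf_struct F P (struct_of (nnf c R))"
  by (induction R arbitrary: c) (auto simp: struct_of_foldr wf_disj wf_conj wf_neg_atom)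

text \<open>Both polarities are proved together, since \<open>Bar\<close> switches between them.
  Well-formedness supplies the non-emptiness of lists that the laws for \<open>Dis\<close> and
  \<open>Con\<close> require.\<close>

lemma equiv_nnf:
  "wf_struct F P R \<Longrightarrow> (if c then R else Bar R) \<simeq> struct_of (nnf c R)"
proof (induction R arbitrary: c)
  case (Dis Rs)
  have IH: "list_all2 (\<simeq>) (map (\<lambda>R. if c then R else Bar R) Rs) (map (struct_of \<circ> nnf c) Rs)"
    using Dis by (auto simp: list_all2_conv_all_nth)
  show ?case
  proof (cases c)
    case True
    then have "dis_list Rs \<simeq> struct_of (nnf c (Dis Rs))"
      using equiv_disj_cong[OF IH] by (simp add: struct_of_foldr)
    moreover have "Dis Rs \<simeq> dis_list Rs" using Dis.prems by (simp add: equiv_Dis_disj)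
    ultimately show ?thesis using True by (auto intro: equiv_struct.trans)
  next
    case False
    then have "con_list (map Bar Rs) \<simeq> struct_of (nnf c (Dis Rs))"
      using equiv_conj_cong[OF IH] by (simp add: struct_of_foldr)
    moreover have "Bar (Dis Rs) \<simeq> Bar (dis_list Rs)"
      using Dis.prems by (simp add: equiv_Dis_disj bar_closure)
    moreover note equiv_Bar_disj[of Rs]
    ultimately show ?thesis using False by (auto intro: equiv_struct.trans)
  qed
next
  case (Con Rs)
  have IH: "list_all2 (\<simeq>) (map (\<lambda>R. if c then R else Bar R) Rs) (map (struct_of \<circ> nnf c) Rs)"
    using Con by (auto simp: list_all2_conv_all_nth)
  show ?case
  proof (cases c)
    case True
    then have "con_list Rs \<simeq> struct_of (nnf c (Con Rs))"
      using equiv_conj_cong[OF IH] by (simp add: struct_of_foldr)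
    moreover have "Con Rs \<simeq> con_list Rs" using Con.prems by (simp add: equiv_Con_conj)
    ultimately show ?thesis using True by (auto intro: equiv_struct.trans)
  next
    case False
    then have "dis_list (map Bar Rs) \<simeq> struct_of (nnf c (Con Rs))"
      using equiv_disj_cong[OF IH] by (simp add: struct_of_foldr)
    moreover have "Bar (Con Rs) \<simeq> Bar (con_list Rs)"
      using Con.prems by (simp add: equiv_Con_conj bar_closure)
    moreover note equiv_Bar_conj[of Rs]
    ultimately show ?thesis using False by (auto intro: equiv_struct.trans)
  qed
next
  case (Bar R)
  then have "R \<simeq> struct_of (nnf True R)" "Bar R \<simeq> struct_of (nnf False R)"
    using Bar.IH[of True] Bar.IH[of False] by simp_all
  then show ?case by (auto intro: equiv_struct.trans[OF bar_bar])
next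
  case (Exi x R)
  then have "R \<simeq> struct_of (nnf True R)" "Bar R \<simeq> struct_of (nnf False R)"
    using Exi.IH[of True] Exi.IH[of False] by simp_all
  then show ?case by (auto intro: equiv_Exi equiv_Uni equiv_struct.trans[OF bar_exi])
next
  case (Uni x R)
  then have "R \<simeq> struct_of (nnf True R)" "Bar R \<simeq> struct_of (nnf False R)"
    using Uni.IH[of True] Uni.IH[of False] by simp_all
  then show ?case by (auto intro: equiv_Exi equiv_Uni equiv_struct.trans[OF bar_uni])
qed (auto intro: equiv_struct.refl bar_FF bar_TT bar_atom)

section \<open>Instances under parallel substitution\<close>

abbreviation fvs :: "('f, 'p) fm \<Rightarrow> nat set" where
  "fvs a \<equiv> fv (struct_of a)"

fun psubst_trm :: "(nat \<Rightarrow> 'f trm) \<Rightarrow> 'f trm \<Rightarrow> 'f trm" where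
  "psubst_trm \<sigma> (Var x) = \<sigma> x"
| "psubst_trm \<sigma> (Fun f ts) = Fun f (map (psubst_trm \<sigma>) ts)"

fun psubst_atom :: "(nat \<Rightarrow> 'f trm) \<Rightarrow> ('f, 'p) atom \<Rightarrow> ('f, 'p) atom" where
  "psubst_atom \<sigma> (Pos p ts) = Pos p (map (psubst_trm \<sigma>) ts)"
| "psubst_atom \<sigma> (Neg p ts) = Neg p (map (psubst_trm \<sigma>) ts)"

text \<open>Parallel substitution. Bound variables are renamed to the de Bruijn levels \<open>n\<close>, \<open>n + 1\<close> and so on,
  so that nothing is captured as soon as the variables of the substituted terms are below \<open>n\<close>.\<close>

primrec inst :: "nat \<Rightarrow> (nat \<Rightarrow> 'f trm) \<Rightarrow> ('f, 'p) fm \<Rightarrow> ('f, 'p) struct" where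
  "inst n \<sigma> Fls = FF"
| "inst n \<sigma> Tru = TT"
| "inst n \<sigma> (Lit a) = Atm (psubst_atom \<sigma> a)"
| "inst n \<sigma> (Or a b) = Dis [inst n \<sigma> a, inst n \<sigma> b]"
| "inst n \<sigma> (And a b) = Con [inst n \<sigma> a, inst n \<sigma> b]"
| "inst n \<sigma> (Ex x a) = Exi n (inst (Suc n) (\<sigma>(x := Var n)) a)"
| "inst n \<sigma> (All x a) = Uni n (inst (Suc n) (\<sigma>(x := Var n)) a)"

lemma psubst_trm_cong:
  "(\<And>x. x \<in> vars_trm t \<Longrightarrow> \<sigma> x = \<tau> x) \<Longrightarrow> psubst_trm \<sigma> t = psubst_trm \<tau> t"
  by (induction t) auto

lemma psubst_atom_cong:
  "(\<And>x. x \<in> vars_atom a \<Longrightarrow> \<sigma> x = \<tau> x) \<Longrightarrow> psubst_atom \<sigma> a = psubst_atom \<tau> a"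
  by (cases a) (auto intro!: psubst_trm_cong)

lemma inst_cong: "(\<And>x. x \<in> fvs a \<Longrightarrow> \<sigma> x = \<tau> x) \<Longrightarrow> inst n \<sigma> a = inst n \<tau> a"
proof (induction a arbitrary: n \<sigma> \<tau>)
  case (Lit a)
  then show ?case by (auto intro: psubst_atom_cong)
next
  case (Or a b)
  have "inst n \<sigma> a = inst n \<tau> a" by (rule Or.IH(1)) (simp add: Or.prems)
  moreover have "inst n \<sigma> b = inst n \<tau> b" by (rule Or.IH(2)) (simp add: Or.prems)
  ultimately show ?case by simp
next
  case (And a b)
  have "inst n \<sigma> a = inst n \<tau> a" by (rule And.IH(1)) (simp add: And.prems)
  moreover have "inst n \<sigma> b = inst n \<tau> b" by (rule And.IH(2)) (simp add: And.prems)
  ultimately show ?case by simp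
next
  case (Ex x a)
  have "inst (Suc n) (\<sigma>(x := Var n)) a = inst (Suc n) (\<tau>(x := Var n)) a"
    by (rule Ex.IH) (simp add: Ex.prems)
  then show ?case by simp
next
  case (All x a)
  have "inst (Suc n) (\<sigma>(x := Var n)) a = inst (Suc n) (\<tau>(x := Var n)) a"
    by (rule All.IH) (simp add: All.prems)
  then show ?case by simp
qed simp_all

lemma subst_psubst_trm: "subst_trm y t (psubst_trm \<sigma> s) = psubst_trm (subst_trm y t \<circ> \<sigma>) s"
  by (induction s) auto

lemma subst_psubst_atom:
  "subst_atom y t (psubst_atom \<sigma> a) = psubst_atom (subst_trm y t \<circ> \<sigma>) a"
  by (cases a) (simp_all add: subst_psubst_trm)

text \<open>All binders of the instance are named \<open>n\<close> or higher, so
  \<open>subst\<close> passes through each of them. This is a syntactic identity; absence of capture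
  is the separate matter of \<open>free_for_inst\<close>.\<close>

lemma subst_inst: "y < n \<Longrightarrow> subst y t (inst n \<sigma> a) = inst n (subst_trm y t \<circ> \<sigma>) a"
proof (induction a arbitrary: n \<sigma>)
  case (Ex x a)
  have "(subst_trm y t \<circ> \<sigma>(x := Var n)) = (subst_trm y t \<circ> \<sigma>)(x := Var n)"
    using Ex.prems by auto
  then have "subst y t (inst (Suc n) (\<sigma>(x := Var n)) a)
      = inst (Suc n) ((subst_trm y t \<circ> \<sigma>)(x := Var n)) a"
    using Ex.IH[of "Suc n" "\<sigma>(x := Var n)"] Ex.prems by (simp only: less_SucI)
  then show ?case using Ex.prems by (simp only: inst.simps subst.simps) simp
next
  case (All x a)
  have "(subst_trm y t \<circ> \<sigma>(x := Var n)) = (subst_trm y t \<circ> \<sigma>)(x := Var n)"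
    using All.prems by auto
  then have "subst y t (inst (Suc n) (\<sigma>(x := Var n)) a)
      = inst (Suc n) ((subst_trm y t \<circ> \<sigma>)(x := Var n)) a"
    using All.IH[of "Suc n" "\<sigma>(x := Var n)"] All.prems by (simp only: less_SucI)
  then show ?case using All.prems by (simp only: inst.simps subst.simps) simp
qed (simp_all add: subst_psubst_atom)

lemma free_for_inst: "vars_trm t \<subseteq> {..<n} \<Longrightarrow> free_for t y (inst n \<sigma> a)"
proof (induction a arbitrary: n \<sigma>)
  case (Ex x a)
  then have "vars_trm t \<subseteq> {..<Suc n}" "n \<notin> vars_trm t" by auto
  then show ?case using Ex.IH by simp
next
  case (All x a)
  then have "vars_trm t \<subseteq> {..<Suc n}" "n \<notin> vars_trm t" by auto
  then show ?case using All.IH by simp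
qed simp_all

lemma vars_psubst_trm: "vars_trm (psubst_trm \<sigma> t) = (\<Union>x\<in>vars_trm t. vars_trm (\<sigma> x))"
  by (induction t) auto

lemma vars_psubst_atom: "vars_atom (psubst_atom \<sigma> a) = (\<Union>x\<in>vars_atom a. vars_trm (\<sigma> x))"
  by (cases a) (auto simp: vars_psubst_trm)

lemma fv_inst: "fv (inst n \<sigma> a) \<subseteq> (\<Union>x\<in>fvs a. vars_trm (\<sigma> x))"
proof (induction a arbitrary: n \<sigma>)
  case (Ex x a)
  have "fv (inst (Suc n) (\<sigma>(x := Var n)) a) \<subseteq> (\<Union>z\<in>fvs a. vars_trm ((\<sigma>(x := Var n)) z))"
    by (rule Ex.IH)
  also have "\<dots> \<subseteq> insert n (\<Union>z\<in>fvs a - {x}. vars_trm (\<sigma> z))" by (auto split: if_splits)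
  finally show ?case by (simp only: inst.simps struct_of.simps fv.simps) blast
next
  case (All x a)
  have "fv (inst (Suc n) (\<sigma>(x := Var n)) a) \<subseteq> (\<Union>z\<in>fvs a. vars_trm ((\<sigma>(x := Var n)) z))"
    by (rule All.IH)
  also have "\<dots> \<subseteq> insert n (\<Union>z\<in>fvs a - {x}. vars_trm (\<sigma> z))" by (auto split: if_splits)
  finally show ?case by (simp only: inst.simps struct_of.simps fv.simps) blast
next
  case (Or a b)
  show ?case using Or.IH(1)[of n \<sigma>] Or.IH(2)[of n \<sigma>] by auto
next
  case (And a b)
  show ?case using And.IH(1)[of n \<sigma>] And.IH(2)[of n \<sigma>] by auto
qed (auto simp: vars_psubst_atom)

lemma wf_psubst_trm:
  "wf_trm F t \<Longrightarrow> (\<And>x. wf_trm F (\<sigma> x)) \<Longrightarrow> wf_trm F (psubst_trm \<sigma> t)"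
  by (induction t) auto

lemma wf_psubst_atom:
  "wf_atom F P a \<Longrightarrow> (\<And>x. wf_trm F (\<sigma> x)) \<Longrightarrow> wf_atom F P (psubst_atom \<sigma> a)"
  by (cases a) (auto simp: wf_psubst_trm)

lemma wf_inst:
  "wf_struct F P (struct_of a) \<Longrightarrow> (\<And>x. wf_trm F (\<sigma> x)) \<Longrightarrow> wf_struct F P (inst n \<sigma> a)"
  by (induction a arbitrary: n \<sigma>) (auto simp: wf_psubst_atom)

text \<open>Binders named from \<open>n\<close> on then capture nothing, and \<open>n\<close> itself
  is fresh. The restriction to \<open>X\<close> matters: over all variables even \<open>Var\<close>
  has no bound, but over the finitely many free ones every substitution does.\<close>

definition bounded :: "nat \<Rightarrow> (nat \<Rightarrow> 'f trm) \<Rightarrow> nat set \<Rightarrow> bool" where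
  "bounded n \<sigma> X \<longleftrightarrow> (\<forall>x\<in>X. vars_trm (\<sigma> x) \<subseteq> {..<n})"

lemma bounded_mono: "bounded n \<sigma> X \<Longrightarrow> n \<le> m \<Longrightarrow> bounded m \<sigma> X"
  unfolding bounded_def by fastforce

lemma bounded_upd:
  "bounded n \<sigma> (X - {x}) \<Longrightarrow> vars_trm t \<subseteq> {..<n} \<Longrightarrow> bounded n (\<sigma>(x := t)) X"
  unfolding bounded_def by auto

text \<open>This opens a quantifier: a witness put in place of the bound variable \<open>n\<close>
  becomes an update of the pending substitution.\<close>

lemma subst_inst_upd:
  assumes "\<And>z. z \<in> fvs a - {x} \<Longrightarrow> n \<notin> vars_trm (\<sigma> z)" "n < m"
  shows "subst n t (inst m (\<sigma>(x := Var n)) a) = inst m (\<sigma>(x := t)) a"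
proof -
  have "inst m (subst_trm n t \<circ> \<sigma>(x := Var n)) a = inst m (\<sigma>(x := t)) a"
    by (rule inst_cong) (simp add: subst_notin_fv_trm assms(1))
  then show ?thesis by (simp only: subst_inst[OF assms(2)])
qed

lemma rename_inst:
  assumes n: "\<And>z. z \<in> fvs a - {x} \<Longrightarrow> n \<notin> vars_trm (\<sigma> z)"
    and m: "\<And>z. z \<in> fvs a - {x} \<Longrightarrow> m \<notin> vars_trm (\<sigma> z)"
    and k: "n < k" "m < k"
  shows "Exi n (inst k (\<sigma>(x := Var n)) a) \<simeq> Exi m (inst k (\<sigma>(x := Var m)) a)"
    and "Uni n (inst k (\<sigma>(x := Var n)) a) \<simeq> Uni m (inst k (\<sigma>(x := Var m)) a)"
proof -
  let ?R = "inst k (\<sigma>(x := Var n)) a"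
  have "Exi n ?R \<simeq> Exi m (inst k (\<sigma>(x := Var m)) a) \<and> Uni n ?R \<simeq> Uni m (inst k (\<sigma>(x := Var m)) a)"
  proof (cases "m = n")
    case False
    then have "m \<notin> fv ?R"
      using fv_inst[of k "\<sigma>(x := Var n)" a] m by (fastforce split: if_splits)
    moreover have "free_for (Var m) n ?R" using k(2) by (intro free_for_inst) simp
    moreover have "subst n (Var m) ?R = inst k (\<sigma>(x := Var m)) a"
      using n k(1) by (rule subst_inst_upd)
    ultimately show ?thesis using rename_exi[of m ?R n] rename_uni[of m ?R n] by simp
  qed (simp add: equiv_struct.refl)
  then show "Exi n ?R \<simeq> Exi m (inst k (\<sigma>(x := Var m)) a)" "Uni n ?R \<simeq> Uni m (inst k (\<sigma>(x := Var m)) a)"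
    by auto
qed

text \<open>Changing the level renames binders at every depth. The induction hypothesis first moves
  the bodies to a common level, after which only the outermost binder differs and a single renaming
  suffices.\<close>

lemma inst_level: "bounded n \<sigma> (fvs a) \<Longrightarrow> bounded m \<sigma> (fvs a) \<Longrightarrow> inst n \<sigma> a \<simeq> inst m \<sigma> a"
proof (induction a arbitrary: n m \<sigma>)
  case (Or a b)
  then show ?case by (auto simp: bounded_def intro!: equiv_Dis)
next
  case (And a b)
  then show ?case by (auto simp: bounded_def intro!: equiv_Con)
next
  case (Ex x a)
  \<comment> \<open>Above both \<open>n\<close> and \<open>m\<close>, so that neither outer binder
    clashes with an inner one.\<close>
  define k where "k = Suc (max n m)"
  have IH: "inst (Suc l) (\<sigma>(x := Var l)) a \<simeq> inst k (\<sigma>(x := Var l)) a"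
    if "bounded l \<sigma> (fvs a - {x})" "l < k" for l
    using that by (intro Ex.IH bounded_upd) (auto elim!: bounded_mono)
  have "Exi n (inst k (\<sigma>(x := Var n)) a) \<simeq> Exi m (inst k (\<sigma>(x := Var m)) a)"
    using Ex.prems by (intro rename_inst) (auto simp: k_def bounded_def)
  moreover have "Exi n (inst (Suc n) (\<sigma>(x := Var n)) a) \<simeq> Exi n (inst k (\<sigma>(x := Var n)) a)"
    using Ex.prems by (intro equiv_Exi IH) (auto simp: k_def)
  moreover have "Exi m (inst (Suc m) (\<sigma>(x := Var m)) a) \<simeq> Exi m (inst k (\<sigma>(x := Var m)) a)"
    using Ex.prems by (intro equiv_Exi IH) (auto simp: k_def)
  ultimately show ?case by (auto intro: equiv_struct.trans equiv_struct.sym)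
next
  case (All x a)
  define k where "k = Suc (max n m)"
  have IH: "inst (Suc l) (\<sigma>(x := Var l)) a \<simeq> inst k (\<sigma>(x := Var l)) a"
    if "bounded l \<sigma> (fvs a - {x})" "l < k" for l
    using that by (intro All.IH bounded_upd) (auto elim!: bounded_mono)
  have "Uni n (inst k (\<sigma>(x := Var n)) a) \<simeq> Uni m (inst k (\<sigma>(x := Var m)) a)"
    using All.prems by (intro rename_inst) (auto simp: k_def bounded_def)
  moreover have "Uni n (inst (Suc n) (\<sigma>(x := Var n)) a) \<simeq> Uni n (inst k (\<sigma>(x := Var n)) a)"
    using All.prems by (intro equiv_Uni IH) (auto simp: k_def)
  moreover have "Uni m (inst (Suc m) (\<sigma>(x := Var m)) a) \<simeq> Uni m (inst k (\<sigma>(x := Var m)) a)"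
    using All.prems by (intro equiv_Uni IH) (auto simp: k_def)
  ultimately show ?case by (auto intro: equiv_struct.trans equiv_struct.sym)
qed (simp_all add: equiv_struct.refl)

lemma psubst_trm_Var: "psubst_trm Var t = t"
  by (induction t) (auto simp: map_idI)

lemma psubst_atom_Var: "psubst_atom Var a = a"
  by (cases a) (simp_all add: psubst_trm_Var map_idI)

lemma bounded_Var: "bounded n Var X \<longleftrightarrow> X \<subseteq> {..<n}"
  by (auto simp: bounded_def)

lemma equiv_inst_Var: "bounded n Var (fvs a) \<Longrightarrow> struct_of a \<simeq> inst n Var a"
proof (induction a arbitrary: n)
  case (Lit a)
  then show ?case by (simp add: psubst_atom_Var equiv_struct.refl)
next
  case (Or a b)
  then show ?case by (auto simp: bounded_def intro!: equiv_Dis)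
next
  case (And a b)
  then show ?case by (auto simp: bounded_def intro!: equiv_Con)
next
  case (Ex x a)
  define k where "k = Suc (max n x)"
  have "bounded k Var (fvs a)"
    using Ex.prems by (force simp: bounded_Var k_def)
  \<comment> \<open>The substitution is \<open>Var\<close> itself, written as an update so that
    \<open>rename_inst\<close> can turn the binder \<open>x\<close> into \<open>n\<close>.\<close>
  then have "struct_of a \<simeq> inst k (Var(x := Var x)) a"
    using Ex.IH by (simp only: fun_upd_triv)
  then have "Exi x (struct_of a) \<simeq> Exi x (inst k (Var(x := Var x)) a)"
    by (rule equiv_Exi)
  moreover have "Exi x (inst k (Var(x := Var x)) a) \<simeq> Exi n (inst k (Var(x := Var n)) a)"
    using Ex.prems by (intro rename_inst) (auto simp: k_def bounded_Var)
  moreover have "Exi n (inst k (Var(x := Var n)) a) \<simeq> Exi n (inst (Suc n) (Var(x := Var n)) a)"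
    using Ex.prems
    by (intro equiv_Exi inst_level bounded_upd) (auto simp: k_def bounded_Var less_Suc_eq less_max_iff_disj)
  ultimately show ?case by (auto intro: equiv_struct.trans)
next
  case (All x a)
  define k where "k = Suc (max n x)"
  have "bounded k Var (fvs a)"
    using All.prems by (force simp: bounded_Var k_def)
  then have "struct_of a \<simeq> inst k (Var(x := Var x)) a"
    using All.IH by (simp only: fun_upd_triv)
  then have "Uni x (struct_of a) \<simeq> Uni x (inst k (Var(x := Var x)) a)"
    by (rule equiv_Uni)
  moreover have "Uni x (inst k (Var(x := Var x)) a) \<simeq> Uni n (inst k (Var(x := Var n)) a)"
    using All.prems by (intro rename_inst) (auto simp: k_def bounded_Var)
  moreover have "Uni n (inst k (Var(x := Var n)) a) \<simeq> Uni n (inst (Suc n) (Var(x := Var n)) a)"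
    using All.prems
    by (intro equiv_Uni inst_level bounded_upd) (auto simp: k_def bounded_Var less_Suc_eq less_max_iff_disj)
  ultimately show ?case by (auto intro: equiv_struct.trans)
qed (simp_all add: equiv_struct.refl)


section \<open>Completeness\<close>

lemma finite_vars_trm: "finite (vars_trm t)"
  by (induction t) auto

lemma finite_fv: "finite (fv R)"
proof (induction R)
  case (Atm a)
  then show ?case by (cases a) (auto simp: finite_vars_trm)
qed auto

text \<open>A pair \<open>(a, \<sigma>)\<close> stands for an instance of \<open>a\<close>. The counter of an existential formula is the
  index of the next term to be tried as a witness.\<close>

type_synonym ('f, 'p) item = "('f, 'p) fm \<times> (nat \<Rightarrow> 'f trm) \<times> nat"

definition sequent :: "nat \<Rightarrow> ('f, 'p) item list \<Rightarrow> ('f, 'p) struct" where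
  "sequent n \<Gamma> = dis_list (map (\<lambda>(a, \<sigma>, k). inst n \<sigma> a) \<Gamma>)"

definition bounded_items :: "nat \<Rightarrow> ('f, 'p) item list \<Rightarrow> bool" where
  "bounded_items n \<Gamma> \<longleftrightarrow> (\<forall>(a, \<sigma>, k)\<in>set \<Gamma>. bounded n \<sigma> (fvs a))"

definition wf_items ::
  "('f \<times> nat) set \<Rightarrow> ('p \<times> nat) set \<Rightarrow> ('f, 'p) item list \<Rightarrow> bool" where
  "wf_items F P \<Gamma> \<longleftrightarrow> (\<forall>(a, \<sigma>, k)\<in>set \<Gamma>. wf_struct F P (struct_of a) \<and> (\<forall>x. wf_trm F (\<sigma> x)))"

text \<open>By \<open>sequent_level\<close>, one bounded level is as good as any other. Leaving it
  open allows premise and conclusion of the universal rule to be read at different levels.\<close>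

definition provable ::
  "('f \<times> nat) set \<Rightarrow> ('p \<times> nat) set \<Rightarrow> ('f, 'p) item list \<Rightarrow> bool" where
  "provable F P \<Gamma> \<longleftrightarrow> (\<exists>n. bounded_items n \<Gamma> \<and> prov F P (sequent n \<Gamma>))"

lemma sequent_simps [simp]:
  "sequent n [] = FF" "sequent n ((a, \<sigma>, k) # \<Gamma>) = Dis [inst n \<sigma> a, sequent n \<Gamma>]"
  by (simp_all add: sequent_def)

lemma bounded_items_simps [simp]:
  "bounded_items n []"
  "bounded_items n ((a, \<sigma>, k) # \<Gamma>) \<longleftrightarrow> bounded n \<sigma> (fvs a) \<and> bounded_items n \<Gamma>"
  by (simp_all add: bounded_items_def)

lemma bounded_items_append:
  "bounded_items n (\<Gamma> @ \<Delta>) \<longleftrightarrow> bounded_items n \<Gamma> \<and> bounded_items n \<Delta>"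
  by (simp add: bounded_items_def ball_Un)

lemma bounded_items_mono: "bounded_items n \<Gamma> \<Longrightarrow> n \<le> m \<Longrightarrow> bounded_items m \<Gamma>"
  by (auto simp: bounded_items_def elim: bounded_mono)

lemma ex_bounded: "finite X \<Longrightarrow> \<exists>n. bounded n \<sigma> X"
proof -
  assume "finite X"
  then have "finite (\<Union>x\<in>X. vars_trm (\<sigma> x))" by (simp add: finite_vars_trm)
  then obtain n where "(\<Union>x\<in>X. vars_trm (\<sigma> x)) \<subseteq> {..<n}" using finite_nat_iff_bounded by blast
  then show ?thesis unfolding bounded_def by blast
qed

lemma ex_bounded_items: "\<exists>n\<ge>m. bounded_items n \<Gamma>"
proof (induction \<Gamma>)
  case (Cons i \<Gamma>)
  obtain a \<sigma> k where i: "i = (a, \<sigma>, k)" by (cases i)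
  obtain n where n: "bounded n \<sigma> (fvs a)" using ex_bounded finite_fv by blast
  obtain l where l: "m \<le> l" "bounded_items l \<Gamma>" using Cons.IH by blast
  have "bounded_items (max n l) (i # \<Gamma>)"
    using i n l by (auto elim: bounded_mono bounded_items_mono)
  then show ?case using l(1) by (metis max.coboundedI2)
qed auto

lemma sequent_level:
  assumes "bounded_items n \<Gamma>" "bounded_items m \<Gamma>"
  shows "sequent n \<Gamma> \<simeq> sequent m \<Gamma>"
  using assms
proof (induction \<Gamma>)
  case (Cons i \<Gamma>)
  then show ?case by (cases i) (auto intro: equiv_Dis inst_level)
qed (simp add: equiv_struct.refl)

lemma provable_level: "provable F P \<Gamma> \<Longrightarrow> bounded_items n \<Gamma> \<Longrightarrow> prov F P (sequent n \<Gamma>)"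
  unfolding provable_def using sequent_level prov_equiv by blast

lemma provableI: "bounded_items n \<Gamma> \<Longrightarrow> prov F P (sequent n \<Gamma>) \<Longrightarrow> provable F P \<Gamma>"
  unfolding provable_def by blast

lemma provable_rotate: "provable F P (\<Gamma> @ \<Delta>) \<Longrightarrow> provable F P (\<Delta> @ \<Gamma>)"
  unfolding provable_def sequent_def map_append bounded_items_append
  using equiv_disj_rotate prov_equiv by blast

lemma wf_sequent: "wf_items F P \<Gamma> \<Longrightarrow> wf_struct F P (sequent n \<Gamma>)"
  by (auto simp: wf_items_def sequent_def wf_disj wf_inst)

lemma fv_sequent: "bounded_items n \<Gamma> \<Longrightarrow> fv (sequent m \<Gamma>) \<subseteq> {..<n}"
proof (induction \<Gamma>)
  case (Cons i \<Gamma>)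
  obtain a \<sigma> k where i: "i = (a, \<sigma>, k)" by (cases i)
  have "fv (inst m \<sigma> a) \<subseteq> (\<Union>x\<in>fvs a. vars_trm (\<sigma> x))" by (rule fv_inst)
  also have "\<dots> \<subseteq> {..<n}" using Cons.prems i by (auto simp: bounded_def)
  finally show ?case using Cons i by simp
qed simp

section \<open>Fair proof search\<close>

text \<open>A conjunction keeps only one conjunct, the one whose premise stays unprovable. Units and
  literals are queued again, so the search never runs dry. The variable \<open>y\<close> is
  arbitrary here: its freshness matters for unprovability in \<open>ex_expands\<close>, while the
  countermodel asks only for some instance.\<close>

inductive expands :: "(nat \<Rightarrow> 'f trm) \<Rightarrow> ('f, 'p) item \<Rightarrow> ('f, 'p) item list \<Rightarrow> bool" for e where
  Fls: "expands e (Fls, \<sigma>, k) [(Fls, \<sigma>, k)]"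
| Tru: "expands e (Tru, \<sigma>, k) [(Tru, \<sigma>, k)]"
| Lit: "expands e (Lit a, \<sigma>, k) [(Lit a, \<sigma>, k)]"
| Or: "expands e (Or a b, \<sigma>, k) [(a, \<sigma>, 0), (b, \<sigma>, 0)]"
| And_left: "expands e (And a b, \<sigma>, k) [(a, \<sigma>, 0)]"
| And_right: "expands e (And a b, \<sigma>, k) [(b, \<sigma>, 0)]"
| Ex: "expands e (Ex x a, \<sigma>, k) [(a, \<sigma>(x := e k), 0), (Ex x a, \<sigma>, Suc k)]"
| All: "expands e (All x a, \<sigma>, k) [(a, \<sigma>(x := Var y), 0)]"

lemma wf_expands:
  assumes "expands e i new" "wf_items F P (i # \<Gamma>)" "\<And>j. wf_trm F (e j)"
  shows "wf_items F P (\<Gamma> @ new)"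
  using assms by (cases rule: expands.cases) (auto simp: wf_items_def)

lemma expands_nonempty: "expands e i new \<Longrightarrow> new \<noteq> []"
  by (cases rule: expands.cases) auto

text \<open>Contrapositive of the derived sequent rules. The new items are first placed in front,
  where those rules act, and then rotated to the end of the queue.\<close>

lemma ex_expands:
  assumes wf: "wf_items F P (i # \<Gamma>)" and e: "\<And>j. wf_trm F (e j)"
    and unprovable: "\<not> provable F P (i # \<Gamma>)"
  shows "\<exists>new. expands e i new \<and> \<not> provable F P (\<Gamma> @ new)"
proof -
  obtain a \<sigma> k where i: "i = (a, \<sigma>, k)" by (cases i)
  have wfa: "wf_struct F P (struct_of a)" and wf\<sigma>: "\<And>x. wf_trm F (\<sigma> x)"
    and wf\<Gamma>: "\<And>n. wf_struct F P (sequent n \<Gamma>)"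
    using wf i by (auto simp: wf_items_def intro!: wf_sequent)
  have "\<exists>new. expands e i new \<and> \<not> provable F P (new @ \<Gamma>)"
  proof (cases a)
    case Fls
    then show ?thesis using unprovable i expands.Fls by fastforce
  next
    case Tru
    then show ?thesis using unprovable i expands.Tru by fastforce
  next
    case (Lit p)
    then show ?thesis using unprovable i expands.Lit by fastforce
  next
    case (Or b c)
    have "provable F P (i # \<Gamma>)" if "provable F P ((b, \<sigma>, 0) # (c, \<sigma>, 0) # \<Gamma>)"
    proof -
      obtain n where n: "bounded_items n (i # \<Gamma>)" using ex_bounded_items by blast
      then have "bounded_items n ((b, \<sigma>, 0) # (c, \<sigma>, 0) # \<Gamma>)"
        by (simp add: i Or bounded_def)
      with that have "prov F P (sequent n ((b, \<sigma>, 0) # (c, \<sigma>, 0) # \<Gamma>))" by (rule provable_level)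
      then have "prov F P (sequent n (i # \<Gamma>))"
        using equiv_Dis_assoc equiv_struct.sym prov_equiv by (simp add: i Or) blast
      with n show ?thesis by (rule provableI)
    qed
    then have "\<not> provable F P ([(b, \<sigma>, 0), (c, \<sigma>, 0)] @ \<Gamma>)" using unprovable by auto
    then show ?thesis unfolding i Or using expands.Or by blast
  next
    case (And b c)
    have "provable F P (i # \<Gamma>)"
      if "provable F P ((b, \<sigma>, 0) # \<Gamma>)" "provable F P ((c, \<sigma>, 0) # \<Gamma>)"
    proof -
      obtain n where n: "bounded_items n (i # \<Gamma>)" using ex_bounded_items by blast
      then have "bounded_items n ((b, \<sigma>, 0) # \<Gamma>)" "bounded_items n ((c, \<sigma>, 0) # \<Gamma>)"
        by (auto simp: i And bounded_def)
      then have "prov F P (sequent n ((b, \<sigma>, 0) # \<Gamma>))" "prov F P (sequent n ((c, \<sigma>, 0) # \<Gamma>))"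
        using that provable_level by blast+
      then have "prov F P (sequent n (i # \<Gamma>))"
        using wfa wf\<sigma> wf\<Gamma> by (simp add: i And prov_Con wf_inst)
      with n show ?thesis by (rule provableI)
    qed
    then have "\<not> provable F P ([(b, \<sigma>, 0)] @ \<Gamma>) \<or> \<not> provable F P ([(c, \<sigma>, 0)] @ \<Gamma>)"
      using unprovable by auto
    then show ?thesis unfolding i And using expands.And_left expands.And_right by blast
  next
    case (Ex x b)
    have "provable F P (i # \<Gamma>)"
      if "provable F P ((b, \<sigma>(x := e k), 0) # (Ex x b, \<sigma>, Suc k) # \<Gamma>)"
    proof -
      \<comment> \<open>The witness may contain variables foreign to the sequent; the level must
        exceed these too, or they could be captured.\<close>
      obtain m where m: "vars_trm (e k) \<subseteq> {..<m}"
        using finite_vars_trm finite_nat_iff_bounded by blast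
      obtain n where n: "bounded_items n (i # \<Gamma>)" "m \<le> n" using ex_bounded_items by blast
      let ?B = "inst (Suc n) (\<sigma>(x := Var n)) b" and ?G = "sequent n \<Gamma>"
      have vars: "vars_trm (e k) \<subseteq> {..<n}" using m n(2) by auto
      have bd: "bounded n \<sigma> (fvs b - {x})" using n(1) by (simp add: i Ex)
      then have bd_upd: "bounded n (\<sigma>(x := e k)) (fvs b)" using vars by (rule bounded_upd)
      then have "bounded_items n ((b, \<sigma>(x := e k), 0) # (Ex x b, \<sigma>, Suc k) # \<Gamma>)"
        using n(1) by (simp add: i Ex del: fun_upd_apply)
      with that have "prov F P (sequent n ((b, \<sigma>(x := e k), 0) # (Ex x b, \<sigma>, Suc k) # \<Gamma>))"
        by (rule provable_level)
      then have "prov F P (Dis [inst n (\<sigma>(x := e k)) b, Dis [Exi n ?B, ?G]])" by simp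
      \<comment> \<open>The substituted body stands at level \<open>Suc n\<close>, the premise at
        level \<open>n\<close>; \<open>inst_level\<close> reconciles them.\<close>
      moreover have "inst n (\<sigma>(x := e k)) b \<simeq> subst n (e k) ?B"
      proof -
        have "subst n (e k) ?B = inst (Suc n) (\<sigma>(x := e k)) b"
          using bd by (intro subst_inst_upd) (auto simp: bounded_def)
        then show ?thesis using bd_upd inst_level bounded_mono[OF bd_upd, of "Suc n"] by simp
      qed
      ultimately have "prov F P (Dis [subst n (e k) ?B, Dis [Exi n ?B, ?G]])"
        using equiv_Dis[OF _ equiv_struct.refl] prov_equiv by blast
      moreover have "free_for (e k) n ?B" using vars by (intro free_for_inst) auto
      moreover have "wf_struct F P ?B" using wfa wf\<sigma> by (intro wf_inst) (auto simp: Ex)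
      ultimately have "prov F P (sequent n (i # \<Gamma>))"
        using wf\<Gamma> by (simp add: i Ex prov_Exi)
      with n(1) show ?thesis by (rule provableI)
    qed
    then have "\<not> provable F P ([(b, \<sigma>(x := e k), 0), (Ex x b, \<sigma>, Suc k)] @ \<Gamma>)"
      using unprovable by auto
    then show ?thesis unfolding i Ex using expands.Ex by blast
  next
    case (All x b)
    \<comment> \<open>The level is the eigenvariable: every free variable of the sequent is below
      \<open>n\<close>, and \<open>n\<close> is also the name that \<open>inst n\<close> gives to
      the outer binder. The premise is read at level \<open>Suc n\<close>.\<close>
    obtain n where n: "bounded_items n (i # \<Gamma>)" using ex_bounded_items by blast
    have "provable F P (i # \<Gamma>)" if "provable F P ((b, \<sigma>(x := Var n), 0) # \<Gamma>)"
    proof -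
      have bd: "bounded n \<sigma> (fvs b - {x})" "bounded_items n \<Gamma>"
        using n by (simp_all add: i All)
      have "bounded (Suc n) (\<sigma>(x := Var n)) (fvs b)"
        using bd(1) by (intro bounded_upd) (auto elim: bounded_mono)
      then have "bounded_items (Suc n) ((b, \<sigma>(x := Var n), 0) # \<Gamma>)"
        using bd(2) bounded_items_mono[of n \<Gamma> "Suc n"] by simp
      with that have "prov F P (sequent (Suc n) ((b, \<sigma>(x := Var n), 0) # \<Gamma>))"
        by (rule provable_level)
      then have "prov F P (Dis [Uni n (inst (Suc n) (\<sigma>(x := Var n)) b), sequent (Suc n) \<Gamma>])"
        using fv_sequent[OF bd(2), of "Suc n"] wfa wf\<sigma> wf\<Gamma>
        by (intro prov_Uni) (auto simp: All intro!: wf_inst)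
      moreover have "sequent (Suc n) \<Gamma> \<simeq> sequent n \<Gamma>"
        using bd(2) by (intro sequent_level) (auto elim: bounded_items_mono)
      ultimately have "prov F P (sequent n (i # \<Gamma>))"
        using equiv_Dis[OF equiv_struct.refl] prov_equiv by (simp add: i All) blast
      with n show ?thesis by (rule provableI)
    qed
    then have "\<not> provable F P ([(b, \<sigma>(x := Var n), 0)] @ \<Gamma>)" using unprovable by auto
    then show ?thesis unfolding i All using expands.All by blast
  qed
  then show ?thesis using provable_rotate by blast
qed

definition branch :: "(nat \<Rightarrow> 'f trm) \<Rightarrow> (nat \<Rightarrow> ('f, 'p) item list) \<Rightarrow> bool" where
  "branch e \<Gamma> \<longleftrightarrow>
     (\<forall>n. \<exists>i \<Delta> new. \<Gamma> n = i # \<Delta> \<and> expands e i new \<and> \<Gamma> (Suc n) = \<Delta> @ new)"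

lemma ex_branch:
  fixes \<Gamma>\<^sub>0 :: "('f, 'p) item list"
  assumes "wf_items F P \<Gamma>\<^sub>0" "\<not> provable F P \<Gamma>\<^sub>0" "\<Gamma>\<^sub>0 \<noteq> []" "\<And>j. wf_trm F (e j)"
  obtains \<Gamma> where "branch e \<Gamma>" "\<Gamma> 0 = \<Gamma>\<^sub>0"
    "\<And>n. wf_items F P (\<Gamma> n)" "\<And>n. \<not> provable F P (\<Gamma> n)"
proof -
  \<comment> \<open>The condition for \<open>n = 0\<close> fixes the start of the sequence obtained
    by dependent choice; non-emptiness provides the item to expand.\<close>
  define ok where "ok n \<Gamma> \<longleftrightarrow>
    wf_items F P \<Gamma> \<and> \<not> provable F P \<Gamma> \<and> \<Gamma> \<noteq> [] \<and> (n = 0 \<longrightarrow> \<Gamma> = \<Gamma>\<^sub>0)" for n :: nat and \<Gamma>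
  define step where "step \<Gamma> \<Gamma>' \<longleftrightarrow>
    (\<exists>i \<Delta> new. \<Gamma> = i # \<Delta> \<and> expands e i new \<and> \<Gamma>' = \<Delta> @ new)" for \<Gamma> \<Gamma>' :: "('f, 'p) item list"
  have "\<exists>\<Gamma>. \<forall>n. ok n (\<Gamma> n) \<and> step (\<Gamma> n) (\<Gamma> (Suc n))"
  proof (rule dependent_nat_choice)
    show "\<exists>\<Gamma>. ok 0 \<Gamma>" using assms by (simp add: ok_def)
  next
    fix \<Gamma> n
    assume ok: "ok n \<Gamma>"
    then obtain i \<Delta> where \<Gamma>: "\<Gamma> = i # \<Delta>" by (cases \<Gamma>) (auto simp: ok_def)
    with ok have i: "wf_items F P (i # \<Delta>)" "\<not> provable F P (i # \<Delta>)" by (simp_all add: ok_def)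
    obtain new where new: "expands e i new" "\<not> provable F P (\<Delta> @ new)"
      using ex_expands[OF i(1) _ i(2), of e] assms(4) by blast
    have "ok (Suc n) (\<Delta> @ new)"
      using new wf_expands[OF new(1) i(1)] assms(4) expands_nonempty[OF new(1)]
      by (simp add: ok_def)
    moreover have "step \<Gamma> (\<Delta> @ new)" using \<Gamma> new(1) by (auto simp: step_def)
    ultimately show "\<exists>\<Gamma>'. ok (Suc n) \<Gamma>' \<and> step \<Gamma> \<Gamma>'" by blast
  qed
  then obtain \<Gamma> where \<Gamma>: "\<And>n. ok n (\<Gamma> n)" "\<And>n. step (\<Gamma> n) (\<Gamma> (Suc n))" by blast
  show ?thesis
  proof (rule that)
    show "branch e \<Gamma>" using \<Gamma>(2) by (simp add: branch_def step_def)
  qed (use \<Gamma>(1) in \<open>auto simp: ok_def\<close>)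
qed

definition occurs :: "(nat \<Rightarrow> ('f, 'p) item list) \<Rightarrow> ('f, 'p) item \<Rightarrow> bool" where
  "occurs \<Gamma> i \<longleftrightarrow> (\<exists>n. i \<in> set (\<Gamma> n))"

text \<open>Sequents are queues, so an item at position \<open>p\<close> is expanded after \<open>p\<close> steps.\<close>

lemma branch_position:
  assumes "branch e \<Gamma>"
  shows "p < length (\<Gamma> n) \<Longrightarrow>
    \<exists>m new. expands e (\<Gamma> n ! p) new \<and> set new \<subseteq> set (\<Gamma> m)"
proof (induction p arbitrary: n)
  case 0
  obtain i \<Delta> new where "\<Gamma> n = i # \<Delta>" "expands e i new" "\<Gamma> (Suc n) = \<Delta> @ new"
    using assms branch_def by metis
  then show ?case by (intro exI[of _ "Suc n"] exI[of _ new]) simp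
next
  case (Suc p)
  obtain i \<Delta> new where "\<Gamma> n = i # \<Delta>" "\<Gamma> (Suc n) = \<Delta> @ new"
    using assms branch_def by metis
  then show ?case using Suc.IH[of "Suc n"] Suc.prems by (simp add: nth_append)
qed

lemma occurs_expands:
  assumes "branch e \<Gamma>" "occurs \<Gamma> i"
  obtains new where "expands e i new" "\<And>j. j \<in> set new \<Longrightarrow> occurs \<Gamma> j"
proof -
  obtain n p where "p < length (\<Gamma> n)" "\<Gamma> n ! p = i"
    using assms(2) by (auto simp: occurs_def in_set_conv_nth)
  then obtain m new where "expands e i new" "set new \<subseteq> set (\<Gamma> m)"
    using branch_position[OF assms(1)] by blast
  then show ?thesis by (intro that) (auto simp: occurs_def)
qed

text \<open>Each expansion puts the formula back with the next counter, so starting from 0 every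
  index is reached.\<close>

lemma occurs_Ex:
  assumes "branch e \<Gamma>" "occurs \<Gamma> (Ex x a, \<sigma>, 0)"
  shows "occurs \<Gamma> (a, \<sigma>(x := e k), 0)"
proof -
  have expand: "occurs \<Gamma> (a, \<sigma>(x := e k), 0) \<and> occurs \<Gamma> (Ex x a, \<sigma>, Suc k)"
    if "occurs \<Gamma> (Ex x a, \<sigma>, k)" for k
    using assms(1) that by (rule occurs_expands) (auto elim!: expands.cases)
  have "occurs \<Gamma> (Ex x a, \<sigma>, k)"
    by (induction k) (use assms(2) expand in auto)
  then show ?thesis using expand by blast
qed

text \<open>Complementary literals that appear at different times thus meet in a common
  sequent.\<close>

lemma Lit_persists:
  assumes "branch e \<Gamma>" "(Lit a, \<sigma>, k) \<in> set (\<Gamma> n)" "n \<le> m"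
  shows "(Lit a, \<sigma>, k) \<in> set (\<Gamma> m)"
  using assms(3)
proof (induction m rule: dec_induct)
  case (step m)
  obtain i \<Delta> new where "\<Gamma> m = i # \<Delta>" "expands e i new" "\<Gamma> (Suc m) = \<Delta> @ new"
    using assms(1) branch_def by metis
  then show ?case using step.IH by (auto elim: expands.cases)
qed (rule assms(2))

lemma wf_occurs:
  assumes "\<And>n. wf_items F P (\<Gamma> n)" "occurs \<Gamma> (a, \<sigma>, k)"
  shows "wf_struct F P (struct_of a)" "wf_trm F (\<sigma> x)"
  using assms by (fastforce simp: occurs_def wf_items_def)+

lemma not_occurs_Tru:
  assumes "wf_items F P \<Gamma>" "\<not> provable F P \<Gamma>"
  shows "(Tru, \<sigma>, k) \<notin> set \<Gamma>"
proof
  assume i: "(Tru, \<sigma>, k) \<in> set \<Gamma>"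
  obtain n where n: "bounded_items n \<Gamma>" using ex_bounded_items by blast
  have "TT \<in> set (map (\<lambda>(a, \<sigma>, k). inst n \<sigma> a) \<Gamma>)" using i by force
  then have "prov F P (sequent n \<Gamma>)"
    using wf_sequent[OF assms(1), of n] unfolding sequent_def wf_disj
    by (intro prov_disj_member[of F P TT] prov.base equiv_struct.refl)
  then show False using assms(2) n provableI by blast
qed

lemma not_complementary:
  assumes wf: "\<And>n. wf_items F P (\<Gamma> n)" and unprovable: "\<And>n. \<not> provable F P (\<Gamma> n)"
    and "branch e \<Gamma>"
    and a: "occurs \<Gamma> (Lit a, \<sigma>, k)" "psubst_atom \<sigma> a = Pos p ts"
    and b: "occurs \<Gamma> (Lit b, \<tau>, l)" "psubst_atom \<tau> b = Neg p ts"
  shows False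
proof -
  obtain m m' where "(Lit a, \<sigma>, k) \<in> set (\<Gamma> m)" "(Lit b, \<tau>, l) \<in> set (\<Gamma> m')"
    using a(1) b(1) occurs_def by metis
  then have ab: "(Lit a, \<sigma>, k) \<in> set (\<Gamma> (max m m'))" "(Lit b, \<tau>, l) \<in> set (\<Gamma> (max m m'))"
    using Lit_persists[OF \<open>branch e \<Gamma>\<close>] by simp_all
  obtain n where n: "bounded_items n (\<Gamma> (max m m'))" using ex_bounded_items by blast
  let ?Rs = "map (\<lambda>(a, \<sigma>, k). inst n \<sigma> a) (\<Gamma> (max m m'))"
  have mem: "Atm (Pos p ts) \<in> set ?Rs" "Atm (Neg p ts) \<in> set ?Rs"
    using ab a(2) b(2) by force+
  have wf_Rs: "\<forall>R\<in>set ?Rs. wf_struct F P R"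
    using wf_sequent[OF wf, of n "max m m'"] unfolding sequent_def wf_disj .
  have "Atm (Neg p ts) \<simeq> Bar (Atm (Pos p ts))"
    using bar_atom[of "Pos p ts"] by (simp add: equiv_struct.sym)
  then have axiom: "prov F P (Dis [Atm (Pos p ts), Atm (Neg p ts)])"
    using mem wf_Rs by (intro prov_axiom) blast+
  have "prov F P (sequent n (\<Gamma> (max m m')))"
    unfolding sequent_def by (rule prov_disj_member2[OF axiom mem _ wf_Rs]) simp
  then show False using unprovable n provableI by blast
qed

text \<open>The countermodel lives on the indices of an enumeration \<open>e\<close> of the terms, since there is no
  type whose elements are exactly the well-formed terms.\<close>

definition term_op :: "(nat \<Rightarrow> 'f trm) \<Rightarrow> 'f \<Rightarrow> nat list \<Rightarrow> nat" where
  "term_op e f ds = (SOME d. e d = Fun f (map e ds))"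

text \<open>Atoms are true by default and false only if forced by a positive literal of the branch;
  \<open>not_complementary\<close> then makes the negative literals false. Decoding by
  \<open>e\<close> makes the truth value independent of which index represents a term.\<close>

definition counter_rel ::
  "(nat \<Rightarrow> 'f trm) \<Rightarrow> (nat \<Rightarrow> ('f, 'p) item list) \<Rightarrow> 'p \<Rightarrow> nat list \<Rightarrow> bool" where
  "counter_rel e \<Gamma> p ds \<longleftrightarrow>
     (\<nexists>a \<sigma>. occurs \<Gamma> (Lit a, \<sigma>, 0) \<and> psubst_atom \<sigma> a = Pos p (map e ds))"

section \<open>Falsity of the branch in the countermodel\<close>

text \<open>Nothing is assumed about injectivity of \<open>e\<close>, so the value of a term is
  described only after decoding. That \<open>e\<close> reaches every well-formed term gives
  \<open>SOME\<close> an index to choose.\<close>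

lemma eval_term_op:
  assumes "range e = {t. wf_trm F t}"
  shows "wf_trm F t \<Longrightarrow> e (eval_trm (term_op e) v t) = psubst_trm (\<lambda>x. e (v x)) t"
proof (induction t)
  case (Fun f ts)
  let ?ds = "map (eval_trm (term_op e) v) ts"
  have "wf_trm F (e d)" for d using assms by blast
  then have "wf_trm F (Fun f (map e ?ds))" using Fun.prems by auto
  then obtain d where "e d = Fun f (map e ?ds)" using assms by (metis mem_Collect_eq rangeE)
  then have "e (term_op e f ?ds) = Fun f (map e ?ds)" unfolding term_op_def by (rule someI)
  also have "map e ?ds = map (psubst_trm (\<lambda>x. e (v x))) ts" using Fun by auto
  finally show ?case by (simp only: eval_trm.simps psubst_trm.simps)
qed simp

lemma eval_term_op_list:
  assumes "range e = {t. wf_trm F t}" "\<forall>t\<in>set ts. wf_trm F t"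
  shows "map e (map (eval_trm (term_op e) v) ts) = map (psubst_trm (\<lambda>x. e (v x))) ts"
  using assms(2) by (simp add: eval_term_op[OF assms(1)])

lemma upd_term:
  "(\<lambda>y. e ((v(x := d)) y)) = (\<lambda>y. e (v y))(x := e d)"
  by auto

text \<open>A valuation \<open>v\<close> corresponds to the substitution \<open>e \<circ> v\<close>,
  and updating it by \<open>d\<close> means instantiating by \<open>e d\<close>. Hence an
  existential formula fails because all indices are tried, and a universal one because its
  eigenvariable has an index.\<close>

lemma branch_falsified:
  assumes e: "range e = {t. wf_trm F t}" and branch: "branch e \<Gamma>"
    and wf: "\<And>n. wf_items F P (\<Gamma> n)" and unprovable: "\<And>n. \<not> provable F P (\<Gamma> n)"
  shows "occurs \<Gamma> (a, \<lambda>x. e (v x), 0) \<Longrightarrow>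
    \<not> eval_struct (term_op e) (counter_rel e \<Gamma>) v (struct_of a)"
proof (induction a arbitrary: v)
  case Tru
  then show ?case using not_occurs_Tru[OF wf unprovable] by (auto simp: occurs_def)
next
  case (Lit a)
  have wfa: "wf_atom F P a" using wf_occurs(1)[OF wf Lit] by simp
  show ?case
  proof (cases a)
    case (Pos p ts)
    then have ts: "\<forall>t\<in>set ts. wf_trm F t" using wfa by simp
    have pos: "psubst_atom (\<lambda>x. e (v x)) a = Pos p (map e (map (eval_trm (term_op e) v) ts))"
      by (simp only: Pos psubst_atom.simps eval_term_op_list[OF e ts])
    with Lit show ?thesis
      unfolding struct_of.simps eval_struct.simps Pos eval_atom.simps counter_rel_def
      by blast
  next
    case (Neg p ts)
    then have ts: "\<forall>t\<in>set ts. wf_trm F t" using wfa by simp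
    have neg: "psubst_atom (\<lambda>x. e (v x)) a = Neg p (map e (map (eval_trm (term_op e) v) ts))"
      by (simp only: Neg psubst_atom.simps eval_term_op_list[OF e ts])
    have "counter_rel e \<Gamma> p (map (eval_trm (term_op e) v) ts)"
      unfolding counter_rel_def using not_complementary[OF wf unprovable branch _ _ Lit neg] by blast
    then show ?thesis unfolding Neg by simp
  qed
next
  case (Or a b)
  obtain new where "expands e (Or a b, \<lambda>x. e (v x), 0) new" "\<And>j. j \<in> set new \<Longrightarrow> occurs \<Gamma> j"
    using occurs_expands[OF branch Or.prems] by blast
  then have "occurs \<Gamma> (a, \<lambda>x. e (v x), 0)" "occurs \<Gamma> (b, \<lambda>x. e (v x), 0)" by (auto elim: expands.cases)
  then show ?case using Or.IH by simp
next
  case (And a b)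
  obtain new where "expands e (And a b, \<lambda>x. e (v x), 0) new" "\<And>j. j \<in> set new \<Longrightarrow> occurs \<Gamma> j"
    using occurs_expands[OF branch And.prems] by blast
  then have "occurs \<Gamma> (a, \<lambda>x. e (v x), 0) \<or> occurs \<Gamma> (b, \<lambda>x. e (v x), 0)" by (auto elim: expands.cases)
  then show ?case using And.IH by auto
next
  case (Ex x a)
  have "\<not> eval_struct (term_op e) (counter_rel e \<Gamma>) (v(x := d)) (struct_of a)" for d
  proof (rule Ex.IH)
    show "occurs \<Gamma> (a, \<lambda>y. e ((v(x := d)) y), 0)"
      using occurs_Ex[OF branch Ex.prems, of d] by (simp only: upd_term)
  qed
  then show ?case by simp
next
  case (All x a)
  obtain new where "expands e (All x a, \<lambda>x. e (v x), 0) new" "\<And>j. j \<in> set new \<Longrightarrow> occurs \<Gamma> j"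
    using occurs_expands[OF branch All.prems] by blast
  then obtain y where y: "occurs \<Gamma> (a, (\<lambda>x. e (v x))(x := Var y), 0)"
    by cases auto
  have "wf_trm F (Var y)" by simp
  then obtain d where d: "e d = Var y" using e by (metis mem_Collect_eq rangeE)
  have "\<not> eval_struct (term_op e) (counter_rel e \<Gamma>) (v(x := d)) (struct_of a)"
    by (rule All.IH) (use y d in \<open>simp only: upd_term\<close>)
  then show ?case by auto
qed simp

section \<open>Completeness, first for countable signatures\<close>

instance trm :: (countable) countable
  by countable_datatype

text \<open>The type of function symbols may be uncountable. Encoding the symbols of
  \<open>F\<close> as numbers maps the well-formed terms injectively into a countable type.\<close>

lemma countable_wf_trm:
  assumes "countable F"
  shows "countable {t. wf_trm F t}"
proof -
  let ?f = "to_nat_on (fst ` F)"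
  have inj: "inj_on ?f (fst ` F)" using assms by (simp add: inj_on_to_nat_on)
  have set: "set_trm t \<subseteq> fst ` F" if "wf_trm F t" for t
    using that
  proof (induction t)
    case (Fun f ts)
    have "(f, length ts) \<in> F" using Fun.prems by simp
    then have "f \<in> fst ` F" by (rule rev_image_eqI) simp
    moreover have "set_trm t \<subseteq> fst ` F" if "t \<in> set ts" for t
      using Fun that by simp
    ultimately show ?case by (simp add: UN_subset_iff)
  qed simp
  have "inj_on (map_trm ?f) {t. wf_trm F t}"
  proof (rule inj_onI)
    fix s t assume st: "s \<in> {t. wf_trm F t}" "t \<in> {t. wf_trm F t}" "map_trm ?f s = map_trm ?f t"
    then have sub: "set_trm s \<subseteq> fst ` F" "set_trm t \<subseteq> fst ` F" using set by simp_all
    show "s = t"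
    proof (rule trm.inj_map_strong[OF _ st(3)])
      fix f g assume "f \<in> set_trm s" "g \<in> set_trm t" "?f f = ?f g"
      then show "f = g" using sub by (intro inj_onD[OF inj]) auto
    qed
  qed
  then show ?thesis by (rule countable_image_inj_on[rotated]) (rule countableI_type)
qed

lemma completeness_countable:
  assumes "countable F" and wf: "wf_struct F P R"
    and valid: "\<And>(I :: 'f \<Rightarrow> nat list \<Rightarrow> nat) (Q :: 'p \<Rightarrow> nat list \<Rightarrow> bool) v. eval_struct I Q v R"
  shows "prov F P R"
proof (rule ccontr)
  assume unprovable: "\<not> prov F P R"
  define a where "a = nnf True R"
  have R: "R \<simeq> struct_of a" using equiv_nnf[OF wf, of True] by (simp add: a_def)
  have wfa: "wf_struct F P (struct_of a)" unfolding a_def by (rule wf_nnf[OF wf])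
  define e where "e = from_nat_into {t. wf_trm F t}"
  have "wf_trm F (Var 0)" by simp
  then have e: "range e = {t. wf_trm F t}"
    unfolding e_def using countable_wf_trm[OF assms(1)] by (intro range_from_nat_into) blast+
  have "\<not> provable F P [(a, Var, 0)]"
  proof
    assume "provable F P [(a, Var, 0)]"
    then obtain n where "bounded_items n [(a, Var, 0)]" "prov F P (sequent n [(a, Var, 0)])"
      unfolding provable_def by blast
    then have "bounded n (Var :: nat \<Rightarrow> 'f trm) (fvs a)" "prov F P (Dis [inst n Var a, FF])" by simp_all
    then have "prov F P R"
      using R equiv_inst_Var equiv_Dis_FF prov_equiv equiv_struct.sym by metis
    with unprovable show False ..
  qed
  moreover have "wf_items F P [(a, Var, 0)]" using wfa by (simp add: wf_items_def)
  moreover have "wf_trm F (e j)" for j using e by blast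
  ultimately obtain \<Gamma> where \<Gamma>: "branch e \<Gamma>" "\<Gamma> 0 = [(a, Var, 0)]"
    "\<And>n. wf_items F P (\<Gamma> n)" "\<And>n. \<not> provable F P (\<Gamma> n)"
    using ex_branch[OF _ _ list.distinct(2), of F P "(a, Var, 0)" "[]" e] by blast
  have "\<exists>d. e d = Var x" for x
    using e by (metis mem_Collect_eq rangeE wf_trm.simps(1))
  \<comment> \<open>The search starts with the identity substitution, which must be presented as
    \<open>e \<circ> v\<close> to fit \<open>branch_falsified\<close>.\<close>
  then obtain v where "\<And>x. e (v x) = Var x" by metis
  then have "(\<lambda>x. e (v x)) = Var" by auto
  then have "occurs \<Gamma> (a, \<lambda>x. e (v x), 0)"
    unfolding occurs_def using \<Gamma>(2) by (intro exI[of _ 0]) simp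
  then have "\<not> eval_struct (term_op e) (counter_rel e \<Gamma>) v (struct_of a)"
    by (rule branch_falsified[OF e \<Gamma>(1,3,4)])
  then show False using valid equiv_sound[OF R] by blast
qed

text \<open>The signature may be uncountable. Countability is recovered by restricting it to the finitely
  many function symbols of the structure to be proved.\<close>

lemma wf_trm_restrict: "wf_trm F t \<Longrightarrow> set_trm t \<subseteq> S \<Longrightarrow> wf_trm (F \<inter> S \<times> UNIV) t"
  by (induction t) auto

lemma wf_atom_restrict:
  "wf_atom F P a \<Longrightarrow> set1_atom a \<subseteq> S \<Longrightarrow> wf_atom (F \<inter> S \<times> UNIV) P a"
  by (cases a) (auto intro!: wf_trm_restrict)

lemma wf_struct_restrict:
  "wf_struct F P R \<Longrightarrow> set1_struct R \<subseteq> S \<Longrightarrow> wf_struct (F \<inter> S \<times> UNIV) P R"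
  by (induction R) (auto simp: wf_atom_restrict)

lemma finite_set_trm: "finite (set_trm t)"
  by (induction t) auto

lemma finite_set1_struct: "finite (set1_struct R)"
proof (induction R)
  case (Atm a)
  then show ?case by (cases a) (auto simp: finite_set_trm)
qed auto

lemma wf_trm_mono: "wf_trm F t \<Longrightarrow> F \<subseteq> F' \<Longrightarrow> wf_trm F' t"
  by (induction t) auto

lemma wf_atom_mono: "wf_atom F P a \<Longrightarrow> F \<subseteq> F' \<Longrightarrow> wf_atom F' P a"
  by (cases a) (auto intro: wf_trm_mono)

lemma wf_struct_mono: "wf_struct F P R \<Longrightarrow> F \<subseteq> F' \<Longrightarrow> wf_struct F' P R"
  by (induction R) (auto intro: wf_atom_mono)

lemma prov_mono: "prov F P R \<Longrightarrow> F \<subseteq> F' \<Longrightarrow> prov F' P R"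
  by (induction rule: prov.induct) (auto intro: prov.intros wf_struct_mono)

lemma completeness:
  fixes F :: "('f \<times> nat) set" and R :: "('f, 'p) struct"
  assumes wf: "wf_struct F P R"
    and valid: "\<And>(I :: 'f \<Rightarrow> nat list \<Rightarrow> nat) (Q :: 'p \<Rightarrow> nat list \<Rightarrow> bool) v. eval_struct I Q v R"
  shows "prov F P R"
proof -
  let ?F = "F \<inter> set1_struct R \<times> UNIV"
  have "countable (set1_struct R \<times> (UNIV :: nat set))"
    by (simp add: finite_set1_struct countable_finite)
  then have "countable ?F" by (rule countable_subset[rotated]) blast
  moreover have "wf_struct ?F P R" using wf by (rule wf_struct_restrict) simp
  ultimately have "prov ?F P R" using valid by (rule completeness_countable)
  then show ?thesis by (rule prov_mono) blast
qed

section \<open>Admissibility of sound rules\<close>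

lemma admissible_KSgq:
  fixes \<rho> :: "('f, 'p) rule"
  assumes "sound \<rho> TYPE(nat)"
  shows "admissible F P \<rho> KSgq"
  unfolding admissible_def
proof (intro allI impI)
  fix R :: "('f, 'p) struct" and Ds
  assume Ds: "proof_of F P (KSgq \<union> {\<rho>}) R Ds"
  \<comment> \<open>Completeness is applied to \<open>last Ds\<close> because well-formedness is
    known for the members of the derivation, whereas \<open>R\<close> is only equivalent to
    one.\<close>
  have wf: "wf_struct F P (last Ds)" and R: "last Ds \<simeq> R"
    using Ds by (auto simp: proof_of_def derivation_def)
  have "eval_struct I Q v (last Ds)" for I :: "'f \<Rightarrow> nat list \<Rightarrow> nat" and Q v
    using proof_sound[OF Ds, of I Q v] sound_KSgq assms equiv_sound[OF R, of I Q v] by auto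
  with wf have "prov F P (last Ds)" by (rule completeness)
  then have "prov F P R" using R by (rule prov_equiv)
  then show "\<exists>Ds'. proof_of F P KSgq R Ds'" by (rule prov_imp_proof)
qed

theorem theorem4p11:
  fixes F :: "('f \<times> nat) set" and P :: "('p \<times> nat) set"
  shows "admissible F P i_up KSgq \<and>
         admissible F P w_up KSgq \<and>
         admissible F P c_up KSgq \<and>
         admissible F P u_up KSgq \<and>
         admissible F P n_up KSgq"
  using sound_i_up sound_w_up sound_c_up sound_u_up sound_n_up by (blast intro: admissible_KSgq)

end
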